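(* Let $H=H(x,u_1,\ldots,u_m,v_1,\ldots,v_m)\in C^2(\Omega\times \mathbb{R}^m_+\times \mathbb{R}^m_+)\cap C(\bar\Omega\times\bar{\mathbb{R}}^m_+\times\bar{\mathbb{R}}^m_+)$ satisfy $H(x,0,\ldots,0,0,\ldots,0)=0$ for all $x\in\partial\Omega$. Assume that $\Omega$ is star-shaped with respect to the origin, and that for some real constants $\alpha_1,\ldots,\alpha_m$, all $u_k>0$, $v_k>0$ ($k=1,\ldots,m$), and all $x\in\Omega$, we have $$nH+(2-n)\sum_{k=1}^m\big(\alpha_ku_kH_{u_k}+(1-\alpha_k)v_kH_{v_k}\big)+\sum_{i=1}^n x_iH_{x_i}<0 ,$$ where $H$ and its derivatives are evaluated at $(x,u_1,\ldots,u_m,v_1,\ldots,v_m)$. Then the problem $$\Delta u_k+H_{v_k}=0 \text{ in }\Omega,\quad u_k=0\text{ on }\partial\Omega,\qquad \Delta v_k+H_{u_k}=0\text{ in }\Omega,\quad v_k=0\text{ on }\partial\Omega,\qquad k=1,\ldots,m,$$ has no positive solutions.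
   Context: $\Omega\subset\mathbb{R}^n$ is a bounded domain whose boundary is smooth enough to have an outward unit normal $\nu$ on $\partial\Omega$ and for the divergence theorem to hold. $\Omega$ is star-shaped with respect to the origin if $x\cdot\nu\ge0$ for all $x\in\partial\Omega$. $m\ge1$ is an integer, $\mathbb{R}_+=(0,\infty)$, $\bar{\mathbb{R}}_+=[0,\infty)$. Subscripts on $H$ denote partial derivatives ($H_{x_i}$ is the derivative with respect to the explicit variable $x_i$); in the system they are evaluated at $(x,u_1(x),\ldots,u_m(x),v_1(x),\ldots,v_m(x))$. Solutions are classical: all $u_k,v_k\in C^2(\Omega)\cap C^1(\bar\Omega)$. A solution is called positive if $u_k(x)>0$ and $v_k(x)>0$ for all $x\in\Omega$ and all $k$. *)

theory Defs
  imports "HOL-Analysis.Analysis"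
begin

section \<open>Differentiability classes and differential operators\<close>

definition C1_on :: "'a::real_normed_vector set \<Rightarrow> ('a \<Rightarrow> 'b::real_normed_vector) \<Rightarrow> bool" where
  "C1_on S f \<longleftrightarrow>
     (\<exists>f'. (\<forall>x\<in>S. (f has_derivative blinfun_apply (f' x)) (at x)) \<and> continuous_on S f')"

definition C2_on :: "'a::real_normed_vector set \<Rightarrow> ('a \<Rightarrow> 'b::real_normed_vector) \<Rightarrow> bool" where
  "C2_on S f \<longleftrightarrow>
     (\<exists>f'. (\<forall>x\<in>S. (f has_derivative blinfun_apply (f' x)) (at x)) \<and> C1_on S f')"

text \<open>The class of functions that are continuously differentiable in the open set \<open>\<Omega>\<close> and that,
  together with their derivative, extend continuously to the closure of \<open>\<Omega>\<close>.\<close>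

definition C1_closure :: "'a::real_normed_vector set \<Rightarrow> ('a \<Rightarrow> 'b::real_normed_vector) \<Rightarrow> bool" where
  "C1_closure \<Omega> f \<longleftrightarrow> continuous_on (closure \<Omega>) f \<and>
     (\<exists>f'. (\<forall>x\<in>\<Omega>. (f has_derivative blinfun_apply (f' x)) (at x)) \<and>
           continuous_on (closure \<Omega>) f')"

definition dderiv :: "'a::real_normed_vector \<Rightarrow> ('a \<Rightarrow> real) \<Rightarrow> 'a \<Rightarrow> real" where
  "dderiv e f x = deriv (\<lambda>t. f (x + t *\<^sub>R e)) 0"

definition laplacian :: "(real^'n \<Rightarrow> real) \<Rightarrow> real^'n \<Rightarrow> real" where
  "laplacian f x = (\<Sum>i\<in>UNIV. dderiv (axis i 1) (dderiv (axis i 1) f) x)"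

definition divergence :: "(real^'n \<Rightarrow> real^'n) \<Rightarrow> real^'n \<Rightarrow> real" where
  "divergence F x = (\<Sum>i\<in>UNIV. dderiv (axis i 1) (\<lambda>y. F y $ i) x)"


section \<open>Domains\<close>

text \<open>\<open>w\<close> is the outward unit normal to \<open>\<Omega>\<close> at the boundary point \<open>x\<close>: the hyperplane through \<open>x\<close>
  orthogonal to \<open>w\<close> is tangent to the boundary, and near \<open>x\<close> the set \<open>\<Omega>\<close> lies on the side
  opposite to \<open>w\<close>.  If \<open>\<Omega>\<close> is given near \<open>x\<close> by \<open>\<rho> < 0\<close> with \<open>\<rho>\<close> of class
  \<open>C\<^sup>1\<close>, \<open>\<rho> x = 0\<close> and nonvanishing gradient, this is the normalized gradient of \<open>\<rho>\<close>.\<close>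

definition outward_unit_normal :: "'a::real_inner set \<Rightarrow> 'a \<Rightarrow> 'a \<Rightarrow> bool" where
  "outward_unit_normal \<Omega> x w \<longleftrightarrow> norm w = 1 \<and>
     (\<forall>\<epsilon>>0. \<exists>\<delta>>0. \<forall>y\<in>ball x \<delta>.
        ((y - x) \<bullet> w < - \<epsilon> * norm (y - x) \<longrightarrow> y \<in> \<Omega>) \<and>
        ((y - x) \<bullet> w > \<epsilon> * norm (y - x) \<longrightarrow> y \<notin> \<Omega>))"

text \<open>The divergence theorem for \<open>\<Omega>\<close>, with boundary normal \<open>\<nu>\<close> and surface measure \<open>\<sigma>\<close>.
  Only fields of class \<open>C\<^sup>1\<close> on the whole space are tested; this already determines the
  restriction of \<open>\<sigma>\<close> to the boundary when \<open>\<nu>\<close> is a field of unit vectors.\<close>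

definition divergence_theorem ::
    "(real^'n) set \<Rightarrow> (real^'n \<Rightarrow> real^'n) \<Rightarrow> (real^'n) measure \<Rightarrow> bool" where
  "divergence_theorem \<Omega> \<nu> \<sigma> \<longleftrightarrow> sets \<sigma> = sets borel \<and> finite_measure \<sigma> \<and>
     (\<forall>F. C1_on UNIV F \<longrightarrow>
        set_integrable \<sigma> (frontier \<Omega>) (\<lambda>x. F x \<bullet> \<nu> x) \<and>
        (LINT x:\<Omega>|lborel. divergence F x) = (LINT x:frontier \<Omega>|\<sigma>. F x \<bullet> \<nu> x))"

definition smooth_bounded_domain :: "(real^'n) set \<Rightarrow> (real^'n \<Rightarrow> real^'n) \<Rightarrow> bool" where
  "smooth_bounded_domain \<Omega> \<nu> \<longleftrightarrow>
     open \<Omega> \<and> connected \<Omega> \<and> \<Omega> \<noteq> {} \<and> bounded \<Omega> \<and>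
     (\<forall>x\<in>frontier \<Omega>. outward_unit_normal \<Omega> x (\<nu> x)) \<and>
     (\<exists>\<sigma>. divergence_theorem \<Omega> \<nu> \<sigma>)"

text \<open>Star-shapedness with respect to the origin, in terms of the outward unit normal
  (the library's \<open>starlike\<close> is a different notion).\<close>

definition star_shaped :: "'a::real_inner set \<Rightarrow> ('a \<Rightarrow> 'a) \<Rightarrow> bool" where
  "star_shaped \<Omega> \<nu> \<longleftrightarrow> (\<forall>x\<in>frontier \<Omega>. 0 \<le> x \<bullet> \<nu> x)"


section \<open>The Hamiltonian system\<close>

definition pos_orthant :: "(real^'m) set" where
  "pos_orthant = {a. \<forall>k. 0 < a $ k}"

definition nonneg_orthant :: "(real^'m) set" where
  "nonneg_orthant = {a. \<forall>k. 0 \<le> a $ k}"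

type_synonym ('n, 'm) hamiltonian = "(real^'n) \<times> (real^'m) \<times> (real^'m) \<Rightarrow> real"

definition H_x :: "('n::finite, 'm::finite) hamiltonian \<Rightarrow> 'n \<Rightarrow> (real^'n) \<times> (real^'m) \<times> (real^'m) \<Rightarrow> real"
  where "H_x H i = dderiv (axis i 1, 0, 0) H"

definition H_u :: "('n::finite, 'm::finite) hamiltonian \<Rightarrow> 'm \<Rightarrow> (real^'n) \<times> (real^'m) \<times> (real^'m) \<Rightarrow> real"
  where "H_u H k = dderiv (0, axis k 1, 0) H"

definition H_v :: "('n::finite, 'm::finite) hamiltonian \<Rightarrow> 'm \<Rightarrow> (real^'n) \<times> (real^'m) \<times> (real^'m) \<Rightarrow> real"
  where "H_v H k = dderiv (0, 0, axis k 1) H"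

definition classical_solution ::
    "(real^'n) set \<Rightarrow> ('n::finite, 'm::finite) hamiltonian \<Rightarrow>
     (real^'n \<Rightarrow> real^'m) \<Rightarrow> (real^'n \<Rightarrow> real^'m) \<Rightarrow> bool" where
  "classical_solution \<Omega> H u v \<longleftrightarrow> (\<forall>k.
     C2_on \<Omega> (\<lambda>x. u x $ k) \<and> C1_closure \<Omega> (\<lambda>x. u x $ k) \<and>
     C2_on \<Omega> (\<lambda>x. v x $ k) \<and> C1_closure \<Omega> (\<lambda>x. v x $ k) \<and>
     (\<forall>x\<in>\<Omega>. laplacian (\<lambda>y. u y $ k) x + H_v H k (x, u x, v x) = 0 \<and>
             laplacian (\<lambda>y. v y $ k) x + H_u H k (x, u x, v x) = 0) \<and>
     (\<forall>x\<in>frontier \<Omega>. u x $ k = 0 \<and> v x $ k = 0))"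

definition positive_on ::
    "(real^'n) set \<Rightarrow> (real^'n \<Rightarrow> real^'m) \<Rightarrow> (real^'n \<Rightarrow> real^'m) \<Rightarrow> bool" where
  "positive_on \<Omega> u v \<longleftrightarrow> (\<forall>x\<in>\<Omega>. \<forall>k. 0 < u x $ k \<and> 0 < v x $ k)"

end

theory Submission
  imports Defs
begin

text \<open>The proof rests on a Pohozaev identity.  Write \<open>n\<close> for the dimension and suppose that \<open>(u, v)\<close> is
  a positive solution.  Consider the vector field
    \<open>F = \<Sum>\<^sub>k [(x\<bullet>\<nabla>u\<^sub>k)\<nabla>v\<^sub>k + (x\<bullet>\<nabla>v\<^sub>k)\<nabla>u\<^sub>k - (\<nabla>u\<^sub>k\<bullet>\<nabla>v\<^sub>k)x] + H x
          - (2 - n) \<Sum>\<^sub>k [\<alpha>\<^sub>k u\<^sub>k \<nabla>v\<^sub>k + (1 - \<alpha>\<^sub>k) v\<^sub>k \<nabla>u\<^sub>k]\<close>.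
  In its divergence all derivatives of \<open>u\<close> and \<open>v\<close> cancel: those of second order by the equations and the
  symmetry of the Hessians (\<open>rellich_divergence\<close>), those of first order by the chain rule for \<open>H\<close> and the
  choice of the last sum.  The divergence becomes exactly the left-hand side of the assumed
  inequality and is therefore negative in \<open>\<Omega>\<close>.  On the boundary \<open>u\<close>, \<open>v\<close> and \<open>H\<close> vanish, and
  \<open>\<nabla>u\<^sub>k = a\<^sub>k \<nu>\<close>, \<open>\<nabla>v\<^sub>k = b\<^sub>k \<nu>\<close> with \<open>a\<^sub>k, b\<^sub>k \<le> 0\<close> because the positive functions decrease to zero there
  (\<open>boundary_gradient\<close>); so \<open>F\<bullet>\<nu> = (x\<bullet>\<nu>) \<Sum>\<^sub>k a\<^sub>k b\<^sub>k \<ge> 0\<close> by star-shapedness.  The divergence theorem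
  would turn these two signs into a contradiction.

  The difficulty is that \<open>F\<close> is only continuous on the closure of \<open>\<Omega>\<close> and continuously differentiable inside:
  its divergence need not be integrable, whereas \<open>divergence_theorem\<close> speaks of fields that are
  continuously differentiable on the whole space.  Moreover \<open>\<nu>\<close> is a pointwise normal and need not be
  continuous, so the boundary cannot be pushed inwards along it.  The required consequence is
  \<open>outward_flux_imp_nonneg_divergence\<close>, and the idea is that the boundary has finite surface measure in a
  form strong enough for cutting off.  Blowing up at a boundary point, where \<open>\<Omega>\<close> looks like a half-space,
  and testing the divergence theorem with a bump times the normal yields
  \<open>\<sigma>(B(x,r)) \<ge> c r\<^bsup>n-1\<^esup>\<close> for small \<open>r\<close> (\<open>surface_measure_lower_density\<close>).  Vitali's lemma then covers the
  boundary by arbitrarily small balls with \<open>\<Sum> r\<^sub>i\<^bsup>n-1\<^esup>\<close> bounded (\<open>small_ball_cover\<close>), so there are cutoffs \<open>\<psi>\<close> that vanish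
  near the boundary, equal one away from it, and have \<open>\<integral>|\<nabla>\<psi>|\<close> bounded (\<open>finite_balls_cutoff\<close>).  If \<open>G\<close> is a
  polynomial field uniformly close to \<open>F\<close>, then \<open>\<psi>F + (1-\<psi>)G\<close> is a legitimate test field whose flux is almost
  nonnegative and whose divergence has, up to a small integral, a negative upper bound.\<close>

section \<open>Calculus of directional derivatives and divergences\<close>

text \<open>The directional derivatives of the statement are one-variable derivatives along a line; for a
  differentiable function the chain rule turns them into values of the total derivative, which is what all
  later computations use.\<close>

lemma dderiv_eq:
  assumes "(f has_derivative D) (at x)"
  shows "dderiv e f x = D e"
proof -
  have "((\<lambda>t. f (x + t *\<^sub>R e)) has_derivative (\<lambda>t. D (t *\<^sub>R e))) (at 0)"
    by (rule has_derivative_compose[where f = "\<lambda>t. x + t *\<^sub>R e", simplified])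
      (use assms in \<open>auto intro!: derivative_eq_intros\<close>)
  moreover have "(\<lambda>t. D (t *\<^sub>R e)) = (*) (D e)"
    using has_derivative_bounded_linear[OF assms]
    by (auto simp: bounded_linear.linear linear_scale)
  ultimately show ?thesis
    unfolding dderiv_def by (intro DERIV_imp_deriv) (simp add: has_field_derivative_def)
qed

lemma divergence_eq:
  fixes F :: "real^'n \<Rightarrow> real^'n"
  assumes "(F has_derivative D) (at x)"
  shows "divergence F x = (\<Sum>i\<in>UNIV. D (axis i 1) $ i)"
  unfolding divergence_def
  by (intro sum.cong refl dderiv_eq bounded_linear.has_derivative[OF bounded_linear_vec_nth assms])

lemma divergence_cong_open:
  fixes F G :: "real^'n \<Rightarrow> real^'n"
  assumes "open S" "x \<in> S" "\<And>y. y \<in> S \<Longrightarrow> F y = G y" "G differentiable (at x)"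
  shows "divergence F x = divergence G x"
proof -
  obtain D where D: "(G has_derivative D) (at x)" using assms(4) unfolding differentiable_def by blast
  have "(F has_derivative D) (at x)"
    using has_derivative_transform_within_open[OF D assms(1,2)] assms(3) by simp
  then show ?thesis using divergence_eq D by metis
qed

lemma divergence_add:
  fixes F G :: "real^'n \<Rightarrow> real^'n"
  assumes "F differentiable (at x)" "G differentiable (at x)"
  shows "divergence (\<lambda>y. F y + G y) x = divergence F x + divergence G x"
proof -
  obtain A B where "(F has_derivative A) (at x)" "(G has_derivative B) (at x)"
    using assms unfolding differentiable_def by blast
  with divergence_eq[OF this(1)] divergence_eq[OF this(2)] divergence_eq[OF has_derivative_add[OF this]]
  show ?thesis by (simp add: sum.distrib)
qed

lemma divergence_diff:
  fixes F G :: "real^'n \<Rightarrow> real^'n"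
  assumes "F differentiable (at x)" "G differentiable (at x)"
  shows "divergence (\<lambda>y. F y - G y) x = divergence F x - divergence G x"
proof -
  obtain A B where "(F has_derivative A) (at x)" "(G has_derivative B) (at x)"
    using assms unfolding differentiable_def by blast
  with divergence_eq[OF this(1)] divergence_eq[OF this(2)] divergence_eq[OF has_derivative_diff[OF this]]
  show ?thesis by (simp add: sum_subtractf)
qed

lemma divergence_sum:
  fixes F :: "'i \<Rightarrow> real^'n \<Rightarrow> real^'n"
  assumes "finite I" "\<And>i. i \<in> I \<Longrightarrow> F i differentiable (at x)"
  shows "divergence (\<lambda>y. \<Sum>i\<in>I. F i y) x = (\<Sum>i\<in>I. divergence (F i) x)"
  using assms
proof (induction I rule: finite_induct)
  case empty
  have "divergence (\<lambda>y. 0 :: real^'n) x = 0"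
    by (subst divergence_eq[OF has_derivative_const]) simp
  then show ?case by simp
next
  case (insert i I)
  then show ?case by (simp add: divergence_add)
qed

text \<open>Expansion in the standard basis, in the form in which sums over coordinates arise from
  divergences and partial derivatives.\<close>

lemma linear_eq_sum_axis:
  fixes L :: "real^'n \<Rightarrow> 'b::real_vector"
  assumes "linear L"
  shows "(\<Sum>i\<in>UNIV. w $ i *\<^sub>R L (axis i 1)) = L w"
proof -
  have "L w = L (\<Sum>i\<in>UNIV. w $ i *\<^sub>R axis i 1)"
    by (simp add: basis_expansion flip: scalar_mult_eq_scaleR)
  also have "\<dots> = (\<Sum>i\<in>UNIV. w $ i *\<^sub>R L (axis i 1))"
    using assms by (simp add: linear_sum linear_scale)
  finally show ?thesis by simp
qed

lemma divergence_scaleR: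
  fixes V :: "real^'n \<Rightarrow> real^'n"
  assumes s: "(s has_derivative s') (at x)" and V: "V differentiable (at x)"
  shows "divergence (\<lambda>y. s y *\<^sub>R V y) x = s' (V x) + s x * divergence V x"
proof -
  obtain A where A: "(V has_derivative A) (at x)"
    using V unfolding differentiable_def by blast
  have lin: "linear s'"
    using has_derivative_bounded_linear[OF s] by (rule bounded_linear.linear)
  have "divergence (\<lambda>y. s y *\<^sub>R V y) x
      = s x * (\<Sum>i\<in>UNIV. A (axis i 1) $ i) + (\<Sum>i\<in>UNIV. V x $ i *\<^sub>R s' (axis i 1))"
    by (subst divergence_eq[OF has_derivative_scaleR[OF s A]])
      (simp add: sum.distrib sum_distrib_left mult_ac)
  then show ?thesis
    using linear_eq_sum_axis[OF lin, of "V x"] divergence_eq[OF A] by simp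
qed

lemma divergence_ident: "divergence (\<lambda>y. y) x = real CARD('n)" for x :: "real^'n"
  by (subst divergence_eq[OF has_derivative_ident]) simp

section \<open>Continuously differentiable functions\<close>

text \<open>In finite dimensions continuity of the derivative in operator norm can be tested on fixed
  directions.  This rule and its converse allow working with plain derivatives instead of bundled bounded linear
  maps.\<close>

lemma C1_onI:
  fixes f :: "'a::euclidean_space \<Rightarrow> 'b::real_normed_vector"
  assumes D: "\<And>x. x \<in> S \<Longrightarrow> (f has_derivative D x) (at x)"
    and cont: "\<And>h. continuous_on S (\<lambda>x. D x h)"
  shows "C1_on S f"
  unfolding C1_on_def
proof (intro exI conjI ballI)
  have eq: "blinfun_apply (Blinfun (D x)) = D x" if "x \<in> S" for x
    using D[OF that] by (intro bounded_linear_Blinfun_apply has_derivative_bounded_linear)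
  show "(f has_derivative blinfun_apply (Blinfun (D x))) (at x)" if "x \<in> S" for x
    using D that eq by simp
  show "continuous_on S (\<lambda>x. Blinfun (D x))"
    by (intro continuous_on_blinfun_componentwise) (simp add: eq cont cong: continuous_on_cong)
qed

lemma C1_onE:
  assumes "C1_on S f"
  obtains D where "\<And>x. x \<in> S \<Longrightarrow> (f has_derivative D x) (at x)"
    and "\<And>g. continuous_on S g \<Longrightarrow> continuous_on S (\<lambda>x. D x (g x))"
proof -
  obtain f' where f': "\<forall>x\<in>S. (f has_derivative blinfun_apply (f' x)) (at x)" "continuous_on S f'"
    using assms unfolding C1_on_def by blast
  show ?thesis
    by (rule that[of "\<lambda>x. blinfun_apply (f' x)"]) (use f' in \<open>auto intro!: continuous_intros\<close>)
qed

lemma C1_on_imp_differentiable: "C1_on S f \<Longrightarrow> x \<in> S \<Longrightarrow> f differentiable (at x)"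
  unfolding C1_on_def differentiable_def by blast

lemma C1_on_imp_continuous_on: "C1_on S f \<Longrightarrow> continuous_on S f"
  by (meson C1_on_imp_differentiable continuous_at_imp_continuous_on differentiable_imp_continuous_within)

lemma C1_on_subset: "C1_on S f \<Longrightarrow> T \<subseteq> S \<Longrightarrow> C1_on T f"
  unfolding C1_on_def by (meson continuous_on_subset subset_iff)

lemma C1_on_cong:
  assumes "open S" "C1_on S f" "\<And>x. x \<in> S \<Longrightarrow> f x = g x"
  shows "C1_on S g"
  using assms unfolding C1_on_def by (metis has_derivative_transform_within_open)

text \<open>Glueing: the derivatives on two overlapping open sets agree with the Frechet derivative, which
  is continuous on each of them.\<close>

lemma C1_on_open_Un:
  fixes f :: "'a::euclidean_space \<Rightarrow> 'b::real_normed_vector"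
  assumes "open S" "open T" "C1_on S f" "C1_on T f"
  shows "C1_on (S \<union> T) f"
proof (rule C1_onI)
  let ?D = "\<lambda>x. frechet_derivative f (at x)"
  have *: "continuous_on U (\<lambda>x. ?D x h)" if U: "C1_on U f" for U h
  proof -
    obtain D where D: "\<And>x. x \<in> U \<Longrightarrow> (f has_derivative D x) (at x)"
      "\<And>g. continuous_on U g \<Longrightarrow> continuous_on U (\<lambda>x. D x (g x))"
      using C1_onE[OF U] by blast
    have "?D x = D x" if "x \<in> U" for x
      using D(1)[OF that] frechet_derivative_at by metis
    then show ?thesis using D(2)[of "\<lambda>_. h"] by (simp cong: continuous_on_cong)
  qed
  show "(f has_derivative ?D x) (at x)" if "x \<in> S \<union> T" for x
    using that assms C1_on_imp_differentiable frechet_derivative_works by blast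
  show "continuous_on (S \<union> T) (\<lambda>x. ?D x h)" for h
    using assms * by (intro continuous_on_open_Un)
qed

lemma C1_on_const: "C1_on S (\<lambda>x::'a::euclidean_space. c)"
  by (rule C1_onI[where D = "\<lambda>_ _. 0"]) auto

lemma C1_on_bounded_linear: "bounded_linear L \<Longrightarrow> C1_on S L"
  for L :: "'a::euclidean_space \<Rightarrow> 'b::real_normed_vector"
  by (rule C1_onI[where D = "\<lambda>_. L"]) (auto intro: bounded_linear_imp_has_derivative)

lemma C1_on_ident: "C1_on S (\<lambda>x::'a::euclidean_space. x)"
  by (rule C1_on_bounded_linear) (rule bounded_linear_ident)

lemma C1_on_add:
  fixes f g :: "'a::euclidean_space \<Rightarrow> 'b::real_normed_vector"
  assumes "C1_on S f" "C1_on S g"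
  shows "C1_on S (\<lambda>x. f x + g x)"
proof -
  obtain A where A: "\<And>x. x \<in> S \<Longrightarrow> (f has_derivative A x) (at x)"
    "\<And>g. continuous_on S g \<Longrightarrow> continuous_on S (\<lambda>x. A x (g x))"
    using C1_onE[OF assms(1)] by blast
  obtain B where B: "\<And>x. x \<in> S \<Longrightarrow> (g has_derivative B x) (at x)"
    "\<And>g. continuous_on S g \<Longrightarrow> continuous_on S (\<lambda>x. B x (g x))"
    using C1_onE[OF assms(2)] by blast
  show ?thesis
    by (rule C1_onI[where D = "\<lambda>x h. A x h + B x h"])
      (intro has_derivative_add continuous_on_add A B continuous_on_const; assumption?)+
qed

lemma C1_on_bilinear:
  fixes f :: "'a::euclidean_space \<Rightarrow> 'b::real_normed_vector"
  assumes b: "bounded_bilinear pr" and "C1_on S f" "C1_on S g"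
  shows "C1_on S (\<lambda>x. pr (f x) (g x))"
proof -
  obtain A where A: "\<And>x. x \<in> S \<Longrightarrow> (f has_derivative A x) (at x)"
    "\<And>g. continuous_on S g \<Longrightarrow> continuous_on S (\<lambda>x. A x (g x))"
    using C1_onE[OF assms(2)] by blast
  obtain B where B: "\<And>x. x \<in> S \<Longrightarrow> (g has_derivative B x) (at x)"
    "\<And>g. continuous_on S g \<Longrightarrow> continuous_on S (\<lambda>x. B x (g x))"
    using C1_onE[OF assms(3)] by blast
  show ?thesis
    by (rule C1_onI[where D = "\<lambda>x h. pr (f x) (B x h) + pr (A x h) (g x)"])
      (intro bounded_bilinear.FDERIV[OF b] continuous_on_add bounded_bilinear.continuous_on[OF b]
        C1_on_imp_continuous_on[OF assms(2)] C1_on_imp_continuous_on[OF assms(3)]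
        A B continuous_on_const; assumption?)+
qed

lemmas C1_on_scaleR = C1_on_bilinear[OF bounded_bilinear_scaleR]
  and C1_on_mult = C1_on_bilinear[OF bounded_bilinear_mult]
  and C1_on_inner = C1_on_bilinear[OF bounded_bilinear_inner]

lemma C1_on_diff:
  fixes f g :: "'a::euclidean_space \<Rightarrow> 'b::real_normed_vector"
  assumes "C1_on S f" "C1_on S g"
  shows "C1_on S (\<lambda>x. f x - g x)"
  using C1_on_add[OF assms(1) C1_on_scaleR[OF C1_on_const[of S "-1"] assms(2)]] by simp

lemma C1_on_sum:
  fixes f :: "'i \<Rightarrow> 'a::euclidean_space \<Rightarrow> 'b::real_normed_vector"
  assumes "\<And>i. i \<in> I \<Longrightarrow> C1_on S (f i)"
  shows "C1_on S (\<lambda>x. \<Sum>i\<in>I. f i x)"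
  using assms
proof (induction I rule: infinite_finite_induct)
  case (insert i I)
  then have "C1_on S (\<lambda>x. f i x + (\<Sum>i\<in>I. f i x))" by (intro C1_on_add) simp_all
  with insert show ?case by simp
qed (simp_all add: C1_on_const)

lemma C1_on_compose:
  fixes f :: "'a::euclidean_space \<Rightarrow> 'b::real_normed_vector"
  assumes f: "C1_on S f" and g: "C1_on T g" and sub: "f ` S \<subseteq> T"
  shows "C1_on S (\<lambda>x. g (f x))"
proof -
  obtain A where A: "\<And>x. x \<in> S \<Longrightarrow> (f has_derivative A x) (at x)"
    "\<And>h. continuous_on S h \<Longrightarrow> continuous_on S (\<lambda>x. A x (h x))"
    using C1_onE[OF f] by blast
  obtain g' where g': "\<forall>y\<in>T. (g has_derivative blinfun_apply (g' y)) (at y)" "continuous_on T g'"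
    using g unfolding C1_on_def by blast
  have "continuous_on S (\<lambda>x. g' (f x))"
    using continuous_on_compose2[OF g'(2) C1_on_imp_continuous_on[OF f] sub] .
  then show ?thesis
  proof (intro C1_onI[where D = "\<lambda>x h. blinfun_apply (g' (f x)) (A x h)"])
    fix x assume "x \<in> S"
    then show "((\<lambda>x. g (f x)) has_derivative (\<lambda>h. blinfun_apply (g' (f x)) (A x h))) (at x)"
      using has_derivative_compose[OF A(1)] g'(1) sub by blast
  next
    show "continuous_on S (\<lambda>x. blinfun_apply (g' (f x)) (A x h))" for h
      using \<open>continuous_on S (\<lambda>x. g' (f x))\<close> A(2)[OF continuous_on_const]
      by (rule bounded_bilinear.continuous_on[OF bounded_bilinear_blinfun_apply])
  qed
qed

lemma C1_on_Pair:
  fixes f :: "'a::euclidean_space \<Rightarrow> 'b::real_normed_vector" and g :: "'a \<Rightarrow> 'c::real_normed_vector"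
  assumes "C1_on S f" "C1_on S g"
  shows "C1_on S (\<lambda>x. (f x, g x))"
proof -
  obtain A where A: "\<And>x. x \<in> S \<Longrightarrow> (f has_derivative A x) (at x)"
    "\<And>g. continuous_on S g \<Longrightarrow> continuous_on S (\<lambda>x. A x (g x))"
    using C1_onE[OF assms(1)] by blast
  obtain B where B: "\<And>x. x \<in> S \<Longrightarrow> (g has_derivative B x) (at x)"
    "\<And>g. continuous_on S g \<Longrightarrow> continuous_on S (\<lambda>x. B x (g x))"
    using C1_onE[OF assms(2)] by blast
  show ?thesis
    by (rule C1_onI[where D = "\<lambda>x h. (A x h, B x h)"])
      (intro has_derivative_Pair continuous_on_Pair A B continuous_on_const; assumption?)+
qed

lemma C1_on_vec:
  fixes f :: "'a::euclidean_space \<Rightarrow> real^'m"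
  assumes "\<And>k. C1_on S (\<lambda>x. f x $ k)"
  shows "C1_on S f"
proof -
  have "C1_on S (\<lambda>x. \<Sum>k\<in>UNIV. f x $ k *\<^sub>R axis k (1::real))"
    by (intro C1_on_sum C1_on_scaleR assms C1_on_const)
  then show ?thesis by (simp add: basis_expansion flip: scalar_mult_eq_scaleR)
qed

lemma C1_on_polynomial_function:
  fixes p :: "'a::euclidean_space \<Rightarrow> real^'m"
  assumes "polynomial_function p"
  shows "C1_on S p"
proof (rule C1_on_vec)
  fix k
  have "C1_on S q" if "real_polynomial_function q" for q :: "'a \<Rightarrow> real"
    using that
    by induction (auto intro: C1_on_bounded_linear C1_on_const C1_on_add C1_on_mult)
  moreover have "real_polynomial_function ((\<lambda>v. v $ k) \<circ> p)"
    using assms unfolding polynomial_function_def by (simp add: bounded_linear_vec_nth)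
  ultimately show "C1_on S (\<lambda>x. p x $ k)" by (simp add: o_def)
qed

lemma C2_on_imp_C1_on:
  assumes "C2_on S f" shows "C1_on S f"
  using assms C1_on_imp_continuous_on unfolding C2_on_def C1_on_def[of S f] by blast

lemma continuous_on_divergence:
  fixes F :: "real^'n \<Rightarrow> real^'n"
  assumes "C1_on S F"
  shows "continuous_on S (divergence F)"
proof -
  obtain D where D: "\<And>x. x \<in> S \<Longrightarrow> (F has_derivative D x) (at x)"
    "\<And>g. continuous_on S g \<Longrightarrow> continuous_on S (\<lambda>x. D x (g x))"
    using C1_onE[OF assms] by blast
  have "continuous_on S (\<lambda>x. \<Sum>i\<in>UNIV. D x (axis i 1) $ i)"
    by (intro continuous_intros D(2))
  then show ?thesis using divergence_eq[OF D(1)] by (simp cong: continuous_on_cong)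
qed

lemma set_integrable_divergence:
  fixes F :: "real^'n \<Rightarrow> real^'n"
  assumes "C1_on UNIV F" "open \<Omega>" "bounded \<Omega>"
  shows "set_integrable lborel \<Omega> (divergence F)"
proof (rule set_integrable_subset)
  show "set_integrable lborel (closure \<Omega>) (divergence F)"
    unfolding set_integrable_def
    using assms by (intro borel_integrable_compact continuous_on_divergence C1_on_subset[OF assms(1)]) auto
qed (use assms closure_subset in auto)

section \<open>Lower density of the surface measure and small covers of the boundary\<close>

definition pos_sq :: "real \<Rightarrow> real" where "pos_sq t = (max 0 t)\<^sup>2"

text \<open>The square of the positive part is the simplest function of class \<open>C\<^sup>1\<close> that vanishes on a half-line;
  all cutoff functions below are built from it.\<close>

lemma DERIV_pos_sq: "(pos_sq has_real_derivative 2 * max 0 t) (at t)"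
proof (rule linorder_cases[of t 0])
  assume t: "t < 0"
  show ?thesis
    by (rule has_field_derivative_transform_within_open[where f = "\<lambda>_. 0" and S = "{..<0}"])
      (use t in \<open>auto simp: pos_sq_def\<close>)
next
  assume t: "t > 0"
  have "((\<lambda>t. t\<^sup>2) has_real_derivative 2 * max 0 t) (at t)"
    using t by (auto intro!: derivative_eq_intros)
  then show ?thesis
    by (rule has_field_derivative_transform_within_open[where S = "{0<..}"])
      (use t in \<open>auto simp: pos_sq_def\<close>)
next
  assume t: "t = 0"
  have "((\<lambda>h. (pos_sq h - pos_sq 0) / h) \<longlongrightarrow> 0) (at 0)"
  proof (rule Lim_null_comparison)
    show "\<forall>\<^sub>F h in at 0. norm ((pos_sq h - pos_sq 0) / h) \<le> \<bar>h\<bar>"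
    proof (intro always_eventually allI)
      show "norm ((pos_sq h - pos_sq 0) / h) \<le> \<bar>h\<bar>" for h
        by (cases "h \<le> 0") (simp_all add: pos_sq_def max_def power2_eq_square)
    qed
    show "((\<lambda>h. \<bar>h\<bar>) \<longlongrightarrow> (0::real)) (at 0)"
      by (auto intro!: tendsto_eq_intros)
  qed
  then show ?thesis
    unfolding t DERIV_def by simp
qed

lemma has_derivative_pos_sq_compose:
  assumes "(f has_derivative D) (at x)"
  shows "((\<lambda>y. pos_sq (f y)) has_derivative (\<lambda>h. 2 * max 0 (f x) * D h)) (at x)"
  using has_derivative_compose[OF assms DERIV_pos_sq[of "f x", unfolded has_field_derivative_def]] .

lemma has_derivative_norm_sq_quotient:
  "((\<lambda>y. (norm (y - a))\<^sup>2 / r\<^sup>2) has_derivative (\<lambda>h. 2 * ((y - a) \<bullet> h) / r\<^sup>2)) (at y)"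
  for a :: "'a::real_inner"
proof -
  have "((\<lambda>y. y - a) has_derivative (\<lambda>h. h)) (at y)"
    using has_derivative_diff[OF has_derivative_ident has_derivative_const[of a]] by simp
  from has_derivative_mult_right[OF has_derivative_inner[OF this this], of "1 / r\<^sup>2"]
  show ?thesis by (simp add: power2_norm_eq_inner inner_commute)
qed

text \<open>The field \<open>\<phi> w\<close>, with \<open>w\<close> the normal at \<open>x\<close> and \<open>\<phi>\<close> a bump of height one on \<open>B(x,r)\<close>, has flux at most
  \<open>\<sigma>(B(x,r))\<close>.  Its divergence is positive on the inner side of the tangent hyperplane and of
  size \<open>1/r\<close> on the ball \<open>B(x - rw/2, r/4)\<close>, which belongs to \<open>\<Omega>\<close> for small \<open>r\<close>.  It is negative only on the outer
  side, where points of \<open>\<Omega>\<close> lie within the thin cone \<open>z\<bullet>w \<le> \<epsilon>|z|\<close> and contribute at most \<open>4\<epsilon>/r\<close> times the volume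
  of the ball.  Choosing \<open>\<epsilon>\<close> small in terms of the dimension leaves a multiple of \<open>r\<^bsup>n-1\<^esup>\<close>.\<close>

lemma surface_measure_lower_density:
  fixes \<Omega> :: "(real^'n) set"
  assumes "open \<Omega>" "bounded \<Omega>" and dt: "divergence_theorem \<Omega> \<nu> \<sigma>"
    and normal: "\<And>y. y \<in> frontier \<Omega> \<Longrightarrow> outward_unit_normal \<Omega> y (\<nu> y)"
    and x: "x \<in> frontier \<Omega>"
  obtains \<delta> where "\<delta> > 0"
    "\<And>r. 0 < r \<Longrightarrow> r < \<delta> \<Longrightarrow>
      unit_ball_vol CARD('n) * 3 / (16 * 4 ^ CARD('n)) * r ^ (CARD('n) - 1)
        \<le> measure \<sigma> (frontier \<Omega> \<inter> ball x r)"
proof -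
  let ?n = "CARD('n)"
  define w where "w = \<nu> x"
  \<comment> \<open>The good ball contributes \<open>7 / (16 * 4 ^ n)\<close> and the thin cone costs \<open>4 * \<epsilon>\<close>, both times the volume
    of the unit ball and \<open>r ^ (n - 1)\<close>; this choice leaves the factor \<open>3 / (16 * 4 ^ n)\<close>.\<close>
  define \<epsilon> :: real where "\<epsilon> = 1 / (16 * 4 ^ ?n)"
  have \<epsilon>: "0 < \<epsilon>" "\<epsilon> < 1/3"
  proof -
    have "(1::real) \<le> 4 ^ ?n" by simp
    then have "(3::real) < 16 * 4 ^ ?n" by linarith
    then show "0 < \<epsilon>" "\<epsilon> < 1/3" by (auto simp: \<epsilon>_def field_simps)
  qed
  have w: "norm w = 1" using normal[OF x] by (simp add: w_def outward_unit_normal_def)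
  obtain \<delta> where \<delta>: "\<delta> > 0"
    "\<And>y. y \<in> ball x \<delta> \<Longrightarrow> (y - x) \<bullet> w < - \<epsilon> * norm (y - x) \<Longrightarrow> y \<in> \<Omega>"
    "\<And>y. y \<in> ball x \<delta> \<Longrightarrow> (y - x) \<bullet> w > \<epsilon> * norm (y - x) \<Longrightarrow> y \<notin> \<Omega>"
    using normal[OF x] \<epsilon>(1) unfolding outward_unit_normal_def w_def by meson
  have sigma: "sets \<sigma> = sets borel" "finite_measure \<sigma>"
    using dt by (auto simp: divergence_theorem_def)
  interpret finite_measure \<sigma> by fact
  show ?thesis
  proof (rule that[OF \<delta>(1)])
    fix r :: real assume r: "0 < r" "r < \<delta>"
    define \<phi> where "\<phi> y = pos_sq (1 - (norm (y - x))\<^sup>2 / r\<^sup>2)" for y :: "real^'n"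
    define \<phi>' where "\<phi>' y h = - 4 * max 0 (1 - (norm (y - x))\<^sup>2 / r\<^sup>2) * ((y - x) \<bullet> h) / r\<^sup>2"
      for y h :: "real^'n"
    have \<phi>: "(\<phi> has_derivative \<phi>' y) (at y)" for y
    proof -
      have "((\<lambda>y. 1 - (norm (y - x))\<^sup>2 / r\<^sup>2) has_derivative (\<lambda>h. 0 - 2 * ((y - x) \<bullet> h) / r\<^sup>2)) (at y)"
        by (intro has_derivative_diff has_derivative_const has_derivative_norm_sq_quotient)
      from has_derivative_pos_sq_compose[OF this] show ?thesis
        unfolding \<phi>_def[abs_def] \<phi>'_def[abs_def] by (simp add: mult_ac)
    qed
    have C1\<phi>: "C1_on UNIV \<phi>"
      using \<phi> by (rule C1_onI) (use r in \<open>auto simp: \<phi>'_def intro!: continuous_intros\<close>)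
    have \<phi>_le: "0 \<le> \<phi> y" "\<phi> y \<le> indicator (ball x r) y" for y
    proof -
      show "0 \<le> \<phi> y" by (simp add: \<phi>_def pos_sq_def)
      show "\<phi> y \<le> indicator (ball x r) y"
      proof (cases "norm (y - x) < r")
        case True
        have "(max 0 (1 - (norm (y - x))\<^sup>2 / r\<^sup>2))\<^sup>2 \<le> 1\<^sup>2"
          by (intro power_mono) auto
        then show ?thesis using True by (simp add: \<phi>_def pos_sq_def dist_norm norm_minus_commute)
      next
        case False
        then have "r\<^sup>2 \<le> (norm (y - x))\<^sup>2" using r by (intro power_mono) auto
        then have "1 - (norm (y - x))\<^sup>2 / r\<^sup>2 \<le> 0" using r by (simp add: field_simps)
        then show ?thesis using False by (simp add: \<phi>_def pos_sq_def dist_norm norm_minus_commute max_def)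
      qed
    qed
    let ?V = "\<lambda>y. \<phi> y *\<^sub>R w"
    have C1V: "C1_on UNIV ?V" by (intro C1_on_scaleR C1\<phi> C1_on_const)
    have div: "divergence ?V y = \<phi>' y w" for y
    proof -
      have "divergence (\<lambda>y. w) y = 0" by (subst divergence_eq[OF has_derivative_const]) simp
      then show ?thesis using divergence_scaleR[OF \<phi>, of "\<lambda>_. w"] by simp
    qed
    let ?B' = "ball (x - (r/2) *\<^sub>R w) (r/4)"
    have pointwise: "7 / (16 * r) * indicator ?B' y - 4 * \<epsilon> / r * indicator (ball x r) y
        \<le> indicator \<Omega> y * divergence ?V y" for y
    proof (cases "norm (y - x) < r")
      case False
      have "?B' \<subseteq> ball x r" using w r by (simp add: ball_subset_ball_iff dist_norm)
      moreover have "y \<notin> ball x r" using False by (simp add: dist_norm norm_minus_commute)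
      moreover have "\<phi>' y w = 0"
      proof -
        have "r\<^sup>2 \<le> (norm (y - x))\<^sup>2" using r False by (intro power_mono) auto
        then have "1 - (norm (y - x))\<^sup>2 / r\<^sup>2 \<le> 0" using r by (simp add: field_simps)
        then show ?thesis by (simp add: \<phi>'_def max_def)
      qed
      ultimately show ?thesis using div by (auto simp: indicator_def)
    next
      case True
      then have yr: "y \<in> ball x r" "y \<in> ball x \<delta>"
        using r by (auto simp: dist_norm norm_minus_commute)
      define z where "z = y - x"
      define q where "q = 1 - (norm z)\<^sup>2 / r\<^sup>2"
      have q: "0 \<le> q" "q \<le> 1"
      proof -
        have "(norm z)\<^sup>2 \<le> r\<^sup>2" using True by (intro power_mono) (auto simp: z_def)
        then show "0 \<le> q" "q \<le> 1" using r by (auto simp: q_def field_simps)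
      qed
      have d: "divergence ?V y = - 4 * q * (z \<bullet> w) / r\<^sup>2"
        using q by (simp add: div \<phi>'_def flip: z_def q_def)
      show ?thesis
      proof (cases "y \<in> ?B'")
        case True
        define e where "e = z + (r/2) *\<^sub>R w"
        have e: "norm e < r/4"
          using True by (simp add: e_def z_def dist_norm norm_minus_commute algebra_simps)
        have "e \<bullet> w \<le> r/4" using norm_cauchy_schwarz[of e w] e w by simp
        then have zw: "z \<bullet> w \<le> - (r/4)"
          using w by (simp add: e_def inner_add_left dot_square_norm)
        have nz: "norm z < 3/4 * r"
          using norm_triangle_ineq4[of e "(r/2) *\<^sub>R w"] e w r by (simp add: e_def)
        have "\<epsilon> * norm z \<le> 1/3 * norm z"
          using \<epsilon> by (intro mult_right_mono) auto
        also have "\<dots> < r/4" using nz by simp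
        finally have "z \<bullet> w < - \<epsilon> * norm z" using zw by simp
        then have yO: "y \<in> \<Omega>" using \<delta>(2) yr by (simp add: z_def)
        have "(norm z)\<^sup>2 \<le> (3/4 * r)\<^sup>2" using nz by (intro power_mono) auto
        then have q7: "7/16 \<le> q" using r by (simp add: q_def field_simps power2_eq_square)
        have "7 / (16 * r) = 4 * (7/16) * (r/4) / r\<^sup>2"
          using r by (simp add: power2_eq_square)
        also have "\<dots> \<le> 4 * q * (- (z \<bullet> w)) / r\<^sup>2"
          using q7 zw r by (intro divide_right_mono mult_mono) auto
        finally have "7 / (16 * r) \<le> divergence ?V y" using d by simp
        moreover have "0 \<le> 4 * \<epsilon> / r" using \<epsilon> r by simp
        ultimately show ?thesis using True yr yO by simp
      next
        case False
        have "- (4 * \<epsilon> / r) \<le> indicator \<Omega> y * divergence ?V y"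
        proof (cases "y \<in> \<Omega>")
          case True
          then have "z \<bullet> w \<le> \<epsilon> * norm z" using \<delta>(3)[OF yr(2)] by (force simp: z_def)
          also have "\<dots> \<le> \<epsilon> * r" using \<epsilon> \<open>norm (y - x) < r\<close> by (simp add: z_def)
          finally have "q * (z \<bullet> w) \<le> q * (\<epsilon> * r)" using q(1) by (intro mult_left_mono)
          also have "\<dots> \<le> 1 * (\<epsilon> * r)" using q r \<epsilon> by (intro mult_right_mono) auto
          finally have "4 * (q * (z \<bullet> w)) / r\<^sup>2 \<le> 4 * (\<epsilon> * r) / r\<^sup>2"
            by (intro divide_right_mono) auto
          also have "\<dots> = 4 * \<epsilon> / r" using r by (simp add: power2_eq_square)
          finally show ?thesis using True d by simp
        qed (use \<epsilon> r in simp)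
        then show ?thesis using False yr by simp
      qed
    qed
    have vol: "measure lborel (ball a s) = unit_ball_vol ?n * s ^ ?n" if "s > 0" for a :: "real^'n" and s
      using content_ball[of s a] that by simp
    have intB: "integrable lborel (\<lambda>y::real^'n. c * indicator (ball a s) y :: real)" for a s c
      by (intro integrable_mult_right integrable_real_indicator) (use emeasure_lborel_ball_finite in auto)
    have rn: "r ^ ?n = r * r ^ (?n - 1)"
      by (simp flip: power_Suc)
    have "unit_ball_vol ?n * 3 / (16 * 4 ^ ?n) * r ^ (?n - 1)
        = 7 / (16 * r) * measure lborel ?B' - 4 * \<epsilon> / r * measure lborel (ball x r)"
      using r by (simp add: vol \<epsilon>_def power_divide rn divide_simps)
    also have "\<dots> = (LINT y|lborel. 7 / (16 * r) * indicator ?B' y - 4 * \<epsilon> / r * indicator (ball x r) y)"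
      by (subst Bochner_Integration.integral_diff) (auto intro!: intB)
    also have "\<dots> \<le> (LINT y:\<Omega>|lborel. divergence ?V y)"
      unfolding set_lebesgue_integral_def
    proof (rule integral_mono)
      show "integrable lborel (\<lambda>y. indicator \<Omega> y *\<^sub>R divergence ?V y)"
        using set_integrable_divergence[OF C1V assms(1,2)] by (simp add: set_integrable_def)
    qed (use pointwise in \<open>auto intro!: intB\<close>)
    also have "\<dots> = (LINT y:frontier \<Omega>|\<sigma>. ?V y \<bullet> \<nu> y)"
      using dt C1V by (simp add: divergence_theorem_def)
    also have "\<dots> \<le> (LINT y|\<sigma>. indicator (frontier \<Omega> \<inter> ball x r) y)"
      unfolding set_lebesgue_integral_def
    proof (rule integral_mono)
      show "integrable \<sigma> (\<lambda>y. indicator (frontier \<Omega>) y *\<^sub>R (?V y \<bullet> \<nu> y))"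
        using dt C1V by (auto simp add: divergence_theorem_def set_integrable_def)
      show "integrable \<sigma> (indicat_real (frontier \<Omega> \<inter> ball x r))"
        using sigma by (intro integrable_real_indicator) (auto simp: less_top[symmetric])
      show "indicator (frontier \<Omega>) y *\<^sub>R (?V y \<bullet> \<nu> y) \<le> indicat_real (frontier \<Omega> \<inter> ball x r) y" for y
      proof (cases "y \<in> frontier \<Omega>")
        case True
        then have "norm (\<nu> y) = 1" using normal by (auto simp: outward_unit_normal_def)
        then have "w \<bullet> \<nu> y \<le> 1" using norm_cauchy_schwarz[of w "\<nu> y"] w by simp
        then have "\<phi> y * (w \<bullet> \<nu> y) \<le> \<phi> y * 1" using \<phi>_le by (intro mult_left_mono)
        then show ?thesis using True \<phi>_le(2)[of y] by (simp add: indicator_inter_arith)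
      qed simp
    qed
    also have "\<dots> = measure \<sigma> (frontier \<Omega> \<inter> ball x r)"
      using sigma by (simp add: sets_eq_imp_space_eq)
    finally show "unit_ball_vol ?n * 3 / (16 * 4 ^ ?n) * r ^ (?n - 1) \<le> measure \<sigma> (frontier \<Omega> \<inter> ball x r)" .
  qed
qed

text \<open>Vitali's lemma selects disjoint balls whose five-fold enlargements cover \<open>S\<close>.  Enlarging by six
  makes the cover open, so finitely many balls suffice, and by disjointness their lower density
  bounds add up to at most the total measure.\<close>

lemma small_ball_cover:
  fixes S :: "'a::euclidean_space set"
  assumes S: "compact S" and fin: "finite_measure \<sigma>" and sets: "sets \<sigma> = sets borel" and c: "c > 0"
    and density: "\<And>x. x \<in> S \<Longrightarrow> \<exists>\<delta>>0. \<forall>r. 0 < r \<and> r < \<delta> \<longrightarrow> c * r ^ m \<le> measure \<sigma> (S \<inter> ball x r)"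
    and \<rho>: "\<rho> > 0"
  obtains C r where "finite C" "C \<subseteq> S" "\<And>x. x \<in> C \<Longrightarrow> 0 < r x \<and> r x < \<rho>"
    "S \<subseteq> (\<Union>x\<in>C. ball x (6 * r x))" "c * (\<Sum>x\<in>C. r x ^ m) \<le> measure \<sigma> S"
proof -
  interpret finite_measure \<sigma> by fact
  obtain \<delta> where \<delta>: "\<And>x. x \<in> S \<Longrightarrow> \<delta> x > 0"
    "\<And>x r. x \<in> S \<Longrightarrow> 0 < r \<Longrightarrow> r < \<delta> x \<Longrightarrow> c * r ^ m \<le> measure \<sigma> (S \<inter> ball x r)"
    using density by metis
  define r where "r x = min (\<delta> x) \<rho> / 2" for x
  have r: "0 < r x" "r x < \<delta> x" "r x < \<rho>" if "x \<in> S" for x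
    using \<delta>(1)[OF that] \<rho> by (auto simp: r_def)
  obtain C where C: "countable C" "C \<subseteq> S"
    "pairwise (\<lambda>i j. disjnt (cball i (r i)) (cball j (r j))) C"
    "S \<subseteq> (\<Union>i\<in>C. cball i (5 * r i))"
  proof (rule Vitali_covering_lemma_cballs[where S = S and K = S and a = "\<lambda>x. x" and r = r and B = \<rho>])
    show "S \<subseteq> (\<Union>i\<in>S. cball i (r i))"
    proof
      show "x \<in> (\<Union>i\<in>S. cball i (r i))" if "x \<in> S" for x
        using that r(1)[OF that] by (intro UN_I[of x]) simp_all
    qed
    show "0 < r i \<and> r i \<le> \<rho>" if "i \<in> S" for i using r[OF that] by simp
  qed blast
  have "S \<subseteq> (\<Union>i\<in>C. ball i (6 * r i))"
  proof
    fix x assume "x \<in> S"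
    then obtain i where "i \<in> C" "x \<in> cball i (5 * r i)" using C(4) by blast
    moreover from this have "0 < r i" using r(1) C(2) by blast
    ultimately show "x \<in> (\<Union>i\<in>C. ball i (6 * r i))" by (intro UN_I[of i]) auto
  qed
  then obtain C' where C': "C' \<subseteq> C" "finite C'" "S \<subseteq> (\<Union>i\<in>C'. ball i (6 * r i))"
    using compactE_image[OF S, of C "\<lambda>i. ball i (6 * r i)"] by (metis open_ball)
  have meas: "S \<inter> ball x s \<in> sets \<sigma>" "S \<in> sets \<sigma>" for x s
    using S by (auto simp: sets compact_imp_closed)
  have "c * (\<Sum>x\<in>C'. r x ^ m) \<le> (\<Sum>x\<in>C'. measure \<sigma> (S \<inter> ball x (r x)))"
    unfolding sum_distrib_left
  proof (rule sum_mono)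
    fix x assume "x \<in> C'"
    then have "x \<in> S" using C' C(2) by blast
    then show "c * r x ^ m \<le> measure \<sigma> (S \<inter> ball x (r x))" using \<delta>(2) r by simp
  qed
  also have "\<dots> = measure \<sigma> (\<Union>x\<in>C'. S \<inter> ball x (r x))"
  proof (rule finite_measure_finite_Union[symmetric])
    have "(S \<inter> ball i (r i)) \<inter> (S \<inter> ball j (r j)) = {}" if "i \<in> C'" "j \<in> C'" "i \<noteq> j" for i j
    proof -
      have "cball i (r i) \<inter> cball j (r j) = {}"
        using pairwiseD[OF C(3)] that C'(1) unfolding disjnt_def by blast
      then show ?thesis using ball_subset_cball by blast
    qed
    then show "disjoint_family_on (\<lambda>x. S \<inter> ball x (r x)) C'"
      unfolding disjoint_family_on_def by blast
  qed (use C' meas in auto)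
  also have "\<dots> \<le> measure \<sigma> S" by (rule finite_measure_mono) (use meas in auto)
  finally have "c * (\<Sum>x\<in>C'. r x ^ m) \<le> measure \<sigma> S" .
  moreover have "0 < r x \<and> r x < \<rho>" if "x \<in> C'" for x
    using that r C'(1) C(2) by (meson subsetD)
  moreover have "C' \<subseteq> S" using C'(1) C(2) by blast
  ultimately show ?thesis using that C'(2,3) by metis
qed

section \<open>Cutoff functions\<close>

text \<open>With \<open>s = |y - a|\<^sup>2 / r\<^sup>2\<close> and \<open>t\<^sub>+\<close> the positive part of \<open>t\<close>, the function
  \<open>(1 - (4 - s)\<^sub>+\<^sup>2 / 9)\<^sub>+\<^sup>2\<close> vanishes for \<open>s \<le> 1\<close> and equals one for \<open>s \<ge> 4\<close>, with derivative of order \<open>1/r\<close>.\<close>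

lemma ball_cutoff:
  fixes a :: "'a::euclidean_space"
  assumes r: "r > 0"
  obtains \<theta> \<theta>' where "\<And>y. (\<theta> has_derivative \<theta>' y) (at y)" "\<And>h. continuous_on UNIV (\<lambda>y. \<theta>' y h)"
    "\<And>y. 0 \<le> \<theta> y \<and> \<theta> y \<le> (1::real)" "\<And>y. y \<in> ball a r \<Longrightarrow> \<theta> y = 0"
    "\<And>y. 1 - \<theta> y \<le> indicator (ball a (2 * r)) y"
    "\<And>y h. \<bar>\<theta>' y h\<bar> \<le> 6 / r * indicator (ball a (2 * r)) y * norm h"
proof -
  define s where "s y = (norm (y - a))\<^sup>2 / r\<^sup>2" for y
  define s' where "s' y h = 2 * ((y - a) \<bullet> h) / r\<^sup>2" for y h
  have s: "(s has_derivative s' y) (at y)" for y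
    unfolding s_def[abs_def] s'_def[abs_def] by (rule has_derivative_norm_sq_quotient)
  have cs: "continuous_on UNIV s" "continuous_on UNIV (\<lambda>y. s' y h)" for h
    using r by (auto simp: s_def[abs_def] s'_def[abs_def] intro!: continuous_intros)
  define q where "q y = 1 - pos_sq (4 - s y) / 9" for y
  define q' where "q' y h = 2 * max 0 (4 - s y) * s' y h / 9" for y h
  have q: "(q has_derivative q' y) (at y)" for y
  proof -
    have "((\<lambda>y. 4 - s y) has_derivative (\<lambda>h. 0 - s' y h)) (at y)"
      by (intro has_derivative_diff has_derivative_const s)
    from has_derivative_diff[OF has_derivative_const[of 1]
        has_derivative_divide[OF has_derivative_pos_sq_compose[OF this] has_derivative_const[of 9]]]
    show ?thesis unfolding q_def[abs_def] q'_def[abs_def] by (simp add: field_simps)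
  qed
  have cq: "continuous_on UNIV q"
    using q by (meson continuous_at_imp_continuous_on has_derivative_continuous)
  define \<theta> where "\<theta> y = pos_sq (q y)" for y
  define \<theta>' where "\<theta>' y h = 2 * max 0 (q y) * q' y h" for y h
  have s0: "0 \<le> s y" for y by (simp add: s_def)
  have q1: "q y \<le> 1" for y by (simp add: q_def pos_sq_def)
  have far: "4 \<le> s y" if "y \<notin> ball a (2 * r)" for y
  proof -
    have "(2 * r)\<^sup>2 \<le> (norm (y - a))\<^sup>2"
      using that r by (intro power_mono) (auto simp: dist_norm norm_minus_commute)
    then show ?thesis using r by (simp add: s_def field_simps)
  qed
  show ?thesis
  proof (rule that)
    show "(\<theta> has_derivative \<theta>' y) (at y)" for y
      unfolding \<theta>_def[abs_def] \<theta>'_def[abs_def] by (rule has_derivative_pos_sq_compose[OF q])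
    show "continuous_on UNIV (\<lambda>y. \<theta>' y h)" for h
      unfolding \<theta>'_def q'_def by (intro continuous_intros cq cs) auto
    show \<theta>01: "0 \<le> \<theta> y \<and> \<theta> y \<le> 1" for y
    proof -
      have "(max 0 (q y))\<^sup>2 \<le> 1\<^sup>2" using q1[of y] by (intro power_mono) auto
      then show ?thesis by (simp add: \<theta>_def pos_sq_def)
    qed
    show "\<theta> y = 0" if "y \<in> ball a r" for y
    proof -
      have "(norm (y - a))\<^sup>2 \<le> r\<^sup>2"
        using that by (intro power_mono) (auto simp: dist_norm norm_minus_commute)
      then have "s y \<le> 1" using r by (simp add: s_def field_simps)
      then have "3\<^sup>2 \<le> (max 0 (4 - s y))\<^sup>2" by (intro power_mono) auto
      then have "q y \<le> 0" by (simp add: q_def pos_sq_def)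
      then show ?thesis by (simp add: \<theta>_def pos_sq_def max_def)
    qed
    show "1 - \<theta> y \<le> indicator (ball a (2 * r)) y" for y
    proof (cases "y \<in> ball a (2 * r)")
      case False
      then show ?thesis using far[OF False] by (simp add: \<theta>_def q_def pos_sq_def max_def)
    qed (use \<theta>01[of y] in simp)
    show "\<bar>\<theta>' y h\<bar> \<le> 6 / r * indicator (ball a (2 * r)) y * norm h" for y h
    proof (cases "y \<in> ball a (2 * r)")
      case False
      then show ?thesis using far[OF False] by (simp add: \<theta>'_def q'_def max_def)
    next
      case True
      then have n: "norm (y - a) \<le> 2 * r" by (simp add: dist_norm norm_minus_commute)
      have "\<bar>s' y h\<bar> = 2 * \<bar>(y - a) \<bullet> h\<bar> / r\<^sup>2" by (simp add: s'_def abs_mult)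
      also have "\<dots> \<le> 2 * (2 * r * norm h) / r\<^sup>2"
        using order_trans[OF Cauchy_Schwarz_ineq2 mult_right_mono[OF n norm_ge_zero], of h]
        by (intro divide_right_mono) auto
      also have "\<dots> = 4 * norm h / r" using r by (simp add: power2_eq_square)
      finally have s': "\<bar>s' y h\<bar> \<le> 4 * norm h / r" .
      have "max 0 (q y) * max 0 (4 - s y) \<le> 3"
      proof (cases "s y \<le> 1")
        case True
        then have "3\<^sup>2 \<le> (max 0 (4 - s y))\<^sup>2" by (intro power_mono) auto
        then have "q y \<le> 0" by (simp add: q_def pos_sq_def)
        then show ?thesis by (simp add: max_def)
      next
        case False
        then have "max 0 (q y) * max 0 (4 - s y) \<le> 1 * 3"
          using q1[of y] by (intro mult_mono) auto
        then show ?thesis by simp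
      qed
      then have "(max 0 (q y) * max 0 (4 - s y)) * \<bar>s' y h\<bar> \<le> 3 * (4 * norm h / r)"
        using s' by (intro mult_mono) auto
      moreover have "\<bar>\<theta>' y h\<bar> = 4 / 9 * ((max 0 (q y) * max 0 (4 - s y)) * \<bar>s' y h\<bar>)"
        by (simp add: \<theta>'_def q'_def abs_mult)
      moreover have "4 / 9 * (3 * (4 * norm h / r)) \<le> 6 / r * norm h"
        using r by (simp add: field_simps)
      ultimately show ?thesis using True by simp
    qed
  qed
qed

text \<open>Products of the cutoffs of single balls.  All estimates are sums over the balls,
  so that their integrals are controlled by sums of powers of the radii.\<close>

lemma finite_balls_cutoff:
  fixes C :: "'a::euclidean_space set"
  assumes "finite C" and R: "\<And>x. x \<in> C \<Longrightarrow> R x > 0"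
  obtains \<psi> \<psi>' where "\<And>y. (\<psi> has_derivative \<psi>' y) (at y)" "\<And>h. continuous_on UNIV (\<lambda>y. \<psi>' y h)"
    "\<And>y. 0 \<le> \<psi> y \<and> \<psi> y \<le> (1::real)" "\<And>y. y \<in> (\<Union>x\<in>C. ball x (R x)) \<Longrightarrow> \<psi> y = 0"
    "\<And>y. 1 - \<psi> y \<le> (\<Sum>x\<in>C. indicator (ball x (2 * R x)) y)"
    "\<And>y h. \<bar>\<psi>' y h\<bar> \<le> (\<Sum>x\<in>C. 6 / R x * indicator (ball x (2 * R x)) y) * norm h"
proof -
  have ex: "\<exists>\<psi> \<psi>'. (\<forall>y. (\<psi> has_derivative \<psi>' y) (at y)) \<and> (\<forall>h. continuous_on UNIV (\<lambda>y. \<psi>' y h)) \<and>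
    (\<forall>y. 0 \<le> \<psi> y \<and> \<psi> y \<le> (1::real)) \<and> (\<forall>y\<in>(\<Union>x\<in>C. ball x (R x)). \<psi> y = 0) \<and>
    (\<forall>y. 1 - \<psi> y \<le> (\<Sum>x\<in>C. indicator (ball x (2 * R x)) y)) \<and>
    (\<forall>y h. \<bar>\<psi>' y h\<bar> \<le> (\<Sum>x\<in>C. 6 / R x * indicator (ball x (2 * R x)) y) * norm h)"
    if "finite C" "\<forall>x\<in>C. R x > 0" for C
    using that
  proof (induction C rule: finite_induct)
    case empty
    show ?case
      by (intro exI[of _ "\<lambda>_. 1"] exI[of _ "\<lambda>_ _. 0"]) simp
  next
    case (insert a C)
    have "\<forall>x\<in>C. R x > 0" using insert.prems by simp
    from insert.IH[OF this] obtain \<psi> \<psi>' where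
      \<psi>12: "\<forall>y. (\<psi> has_derivative \<psi>' y) (at y)" "\<forall>h. continuous_on UNIV (\<lambda>y. \<psi>' y h)"
      and \<psi>34: "\<forall>y. 0 \<le> \<psi> y \<and> \<psi> y \<le> (1::real)"
      and \<psi>5: "\<forall>y\<in>(\<Union>x\<in>C. ball x (R x)). \<psi> y = 0"
      and \<psi>67: "\<forall>y. 1 - \<psi> y \<le> (\<Sum>x\<in>C. indicator (ball x (2 * R x)) y)"
      "\<forall>y h. \<bar>\<psi>' y h\<bar> \<le> (\<Sum>x\<in>C. 6 / R x * indicator (ball x (2 * R x)) y) * norm h"
      by (elim exE conjE)
    have \<psi>: "(\<psi> has_derivative \<psi>' y) (at y)" "continuous_on UNIV (\<lambda>y. \<psi>' y h)"
      "0 \<le> \<psi> y" "\<psi> y \<le> 1" "x \<in> C \<Longrightarrow> y \<in> ball x (R x) \<Longrightarrow> \<psi> y = 0"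
      "1 - \<psi> y \<le> (\<Sum>x\<in>C. indicator (ball x (2 * R x)) y)"
      "\<bar>\<psi>' y h\<bar> \<le> (\<Sum>x\<in>C. 6 / R x * indicator (ball x (2 * R x)) y) * norm h" for x y h
      using \<psi>12 \<psi>34 \<psi>5 \<psi>67 by blast+
    obtain \<theta> \<theta>' where \<theta>: "\<And>y. (\<theta> has_derivative \<theta>' y) (at y)"
      "\<And>h. continuous_on UNIV (\<lambda>y. \<theta>' y h)" "\<And>y. 0 \<le> \<theta> y \<and> \<theta> y \<le> (1::real)"
      "\<And>y. y \<in> ball a (R a) \<Longrightarrow> \<theta> y = 0" "\<And>y. 1 - \<theta> y \<le> indicator (ball a (2 * R a)) y"
      "\<And>y h. \<bar>\<theta>' y h\<bar> \<le> 6 / R a * indicator (ball a (2 * R a)) y * norm h"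
      by (rule ball_cutoff[of "R a" a]) (use insert.prems in simp, blast)
    have cont: "continuous_on UNIV \<psi>" "continuous_on UNIV \<theta>"
      using \<psi>(1) \<theta>(1) by (meson continuous_at_imp_continuous_on has_derivative_continuous)+
    have "((\<lambda>y. \<theta> y * \<psi> y) has_derivative (\<lambda>h. \<theta> y * \<psi>' y h + \<theta>' y h * \<psi> y)) (at y)" for y
      by (rule has_derivative_mult[OF \<theta>(1) \<psi>(1)])
    moreover have "continuous_on UNIV (\<lambda>y. \<theta> y * \<psi>' y h + \<theta>' y h * \<psi> y)" for h
      by (intro continuous_intros cont \<psi>(2) \<theta>(2))
    moreover have "0 \<le> \<theta> y * \<psi> y" "\<theta> y * \<psi> y \<le> 1" for y
      using \<psi>(3,4)[of y] \<theta>(3)[of y] by (simp_all add: mult_le_one)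
    moreover have "\<theta> y * \<psi> y = 0" if "y \<in> (\<Union>x\<in>insert a C. ball x (R x))" for y
      using that \<theta>(4)[of y] \<psi>(5)[of _ y] by auto
    moreover have "1 - \<theta> y * \<psi> y \<le> (\<Sum>x\<in>insert a C. indicator (ball x (2 * R x)) y)" for y
    proof -
      have "(1 - \<theta> y) * (1 - \<psi> y) \<ge> 0" using \<psi>(4)[of y] \<theta>(3)[of y] by simp
      then have "1 - \<theta> y * \<psi> y \<le> (1 - \<theta> y) + (1 - \<psi> y)" by (simp add: algebra_simps)
      then show ?thesis using \<theta>(5)[of y] \<psi>(6)[of y] insert.hyps by simp
    qed
    moreover have "\<bar>\<theta> y * \<psi>' y h + \<theta>' y h * \<psi> y\<bar>
        \<le> (\<Sum>x\<in>insert a C. 6 / R x * indicator (ball x (2 * R x)) y) * norm h" for y h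
    proof -
      have "\<bar>\<theta> y * \<psi>' y h + \<theta>' y h * \<psi> y\<bar> \<le> \<theta> y * \<bar>\<psi>' y h\<bar> + \<bar>\<theta>' y h\<bar> * \<psi> y"
        using abs_triangle_ineq[of "\<theta> y * \<psi>' y h" "\<theta>' y h * \<psi> y"] \<psi>(3)[of y] \<theta>(3)[of y]
        by (simp add: abs_mult)
      also have "\<dots> \<le> 1 * \<bar>\<psi>' y h\<bar> + \<bar>\<theta>' y h\<bar> * 1"
        using \<psi>(4)[of y] \<theta>(3)[of y] by (intro add_mono mult_right_mono mult_left_mono) auto
      also have "\<dots> \<le> (\<Sum>x\<in>insert a C. 6 / R x * indicator (ball x (2 * R x)) y) * norm h"
        using \<theta>(6)[of y h] \<psi>(7)[of y h] insert.hyps by (simp add: distrib_right)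
      finally show ?thesis .
    qed
    ultimately show ?case
      by (intro exI[of _ "\<lambda>y. \<theta> y * \<psi> y"] exI[of _ "\<lambda>y h. \<theta> y * \<psi>' y h + \<theta>' y h * \<psi> y"]
          conjI allI ballI)
  qed
  have "\<forall>x\<in>C. R x > 0" using R by blast
  from ex[OF assms(1) this] show ?thesis
    by (elim exE conjE) (rule that; blast)
qed

section \<open>The sign of the divergence of a field with outward flux\<close>

text \<open>Suppose the divergence is negative throughout.  It is below \<open>-c\<^sub>0\<close> on some ball \<open>K\<close>, and \<open>\<delta>\<close>, the accuracy
  of the polynomial approximation \<open>G\<close>, is chosen small compared with \<open>c\<^sub>0\<close> times the volume of \<open>K\<close>.  For
  \<open>W = \<psi>F + (1-\<psi>)G\<close> one has \<open>div W = (1-\<psi>) div G + \<psi> div F + \<nabla>\<psi>\<bullet>(F-G)\<close>.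
  The first term is bounded and lives on the small balls, whose total volume tends to zero with the maximal
  radius; the second is at most \<open>-c\<^sub>0\<close> on \<open>K\<close> and nonpositive elsewhere; the third is at
  most \<open>\<delta>|\<nabla>\<psi>|\<close>, whose integral is bounded by \<open>\<delta>\<close> times a constant independent of the cover.  The flux of \<open>W\<close> is
  that of \<open>G\<close>, hence at least \<open>-\<delta>\<close> times the surface measure.\<close>

theorem outward_flux_imp_nonneg_divergence:
  fixes F :: "real^'n \<Rightarrow> real^'n"
  assumes dom: "smooth_bounded_domain \<Omega> \<nu>"
    and cont: "continuous_on (closure \<Omega>) F" and C1: "C1_on \<Omega> F"
    and flux: "\<And>x. x \<in> frontier \<Omega> \<Longrightarrow> 0 \<le> F x \<bullet> \<nu> x"
  shows "\<exists>x\<in>\<Omega>. 0 \<le> divergence F x"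
proof (rule ccontr)
  assume "\<not> ?thesis"
  then have neg: "\<And>x. x \<in> \<Omega> \<Longrightarrow> divergence F x < 0" by force
  let ?n = "CARD('n)"
  have \<Omega>: "open \<Omega>" "\<Omega> \<noteq> {}" "bounded \<Omega>"
    and normal: "\<And>y. y \<in> frontier \<Omega> \<Longrightarrow> outward_unit_normal \<Omega> y (\<nu> y)"
    using dom by (auto simp: smooth_bounded_domain_def)
  obtain \<sigma> where dt: "divergence_theorem \<Omega> \<nu> \<sigma>" using dom by (auto simp: smooth_bounded_domain_def)
  have sigma: "sets \<sigma> = sets borel" "finite_measure \<sigma>"
    using dt by (auto simp: divergence_theorem_def)
  interpret finite_measure \<sigma> by fact
  have compact: "compact (closure \<Omega>)" "compact (frontier \<Omega>)"
    using \<Omega> by (auto simp: compact_frontier_bounded)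

  obtain x\<^sub>0 where x0: "x\<^sub>0 \<in> \<Omega>" using \<Omega> by blast
  define c\<^sub>0 where "c\<^sub>0 = - divergence F x\<^sub>0 / 2"
  have c0: "c\<^sub>0 > 0" using neg[OF x0] by (simp add: c\<^sub>0_def)
  have "isCont (divergence F) x\<^sub>0"
    using continuous_on_divergence[OF C1] x0 \<Omega>(1) by (simp add: continuous_on_eq_continuous_at)
  then obtain \<rho>\<^sub>1 where \<rho>1: "\<rho>\<^sub>1 > 0" "\<And>y. dist y x\<^sub>0 < \<rho>\<^sub>1 \<Longrightarrow> \<bar>divergence F y - divergence F x\<^sub>0\<bar> < c\<^sub>0"
    using c0 unfolding continuous_at_eps_delta dist_real_def by meson
  obtain \<rho>\<^sub>2 where \<rho>2: "\<rho>\<^sub>2 > 0" "ball x\<^sub>0 \<rho>\<^sub>2 \<subseteq> \<Omega>" using \<Omega>(1) x0 open_contains_ball by blast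
  \<comment> \<open>The ball \<open>K\<close> has half the radius that fits into \<open>\<Omega>\<close>, so that balls around boundary points with
    radius at most \<open>\<rho>\<^sub>0\<close> do not meet it and the cutoff equals one there.\<close>
  define \<rho>\<^sub>0 where "\<rho>\<^sub>0 = min \<rho>\<^sub>1 (\<rho>\<^sub>2 / 2)"
  have \<rho>0: "\<rho>\<^sub>0 > 0" using \<rho>1 \<rho>2 by (simp add: \<rho>\<^sub>0_def)
  let ?K = "ball x\<^sub>0 \<rho>\<^sub>0"
  have K: "?K \<subseteq> \<Omega>" using \<rho>2 by (auto simp: \<rho>\<^sub>0_def)
  have Kdiv: "divergence F y \<le> - c\<^sub>0" if "y \<in> ?K" for y
    using \<rho>1(2)[of y] that by (simp add: \<rho>\<^sub>0_def dist_commute c\<^sub>0_def)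

  define \<omega> where "\<omega> = unit_ball_vol (real ?n)"
  have \<omega>: "\<omega> > 0" by (simp add: \<omega>_def)
  have vol: "measure lborel (ball a s) = \<omega> * s ^ ?n" if "s > 0" for a :: "real^'n" and s
    using content_ball[of s a] that by (simp add: \<omega>_def)
  define c where "c = \<omega> * 3 / (16 * 4 ^ ?n)"
  have c: "c > 0" using \<omega> by (simp add: c_def)
  define P where "P = measure \<sigma> (frontier \<Omega>)"
  have P: "P \<ge> 0" by (simp add: P_def)
  \<comment> \<open>For any cover by balls as in \<open>small_ball_cover\<close>, \<open>A\<close> bounds the sum of the volumes of the twelve-fold
    enlarged balls, each divided by its original radius.\<close>
  define A where "A = \<omega> * 12 ^ ?n * (P / c)"
  have A: "A \<ge> 0" using \<omega> P c by (simp add: A_def)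
  define V where "V = measure lborel ?K"
  have V: "V > 0" using \<rho>0 \<omega> by (simp add: V_def vol)
  define \<delta> where "\<delta> = c\<^sub>0 * V / (4 * (A + P + 1))"
  have \<delta>: "\<delta> > 0" using c0 V A P by (simp add: \<delta>_def)
  obtain G where G: "polynomial_function G" "\<And>x. x \<in> closure \<Omega> \<Longrightarrow> norm (F x - G x) < \<delta>"
    using Stone_Weierstrass_polynomial_function[OF compact(1) cont \<delta>] by blast
  have C1G: "C1_on S G" for S using G(1) by (rule C1_on_polynomial_function)
  obtain M where M: "M > 0" "\<And>y. y \<in> closure \<Omega> \<Longrightarrow> \<bar>divergence G y\<bar> \<le> M"
  proof -
    have "bounded (divergence G ` closure \<Omega>)"
      by (intro compact_imp_bounded compact_continuous_image continuous_on_divergence C1G compact)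
    then show ?thesis using that unfolding bounded_pos by auto
  qed
  \<comment> \<open>The bound \<open>M * \<rho> \<le> \<delta>\<close> makes the contribution of the divergence of \<open>G\<close> as small as that of the gradient of
    the cutoff.\<close>
  define \<rho> where "\<rho> = min (\<rho>\<^sub>0 / 12) (\<delta> / M)"
  have \<rho>: "\<rho> > 0" "12 * \<rho> \<le> \<rho>\<^sub>0" "M * \<rho> \<le> \<delta>"
    using \<rho>0 \<delta> M(1) by (auto simp: \<rho>_def min_def field_simps)

  have density: "\<exists>\<delta>>0. \<forall>r. 0 < r \<and> r < \<delta> \<longrightarrow> c * r ^ (?n - 1) \<le> measure \<sigma> (frontier \<Omega> \<inter> ball x r)"
    if "x \<in> frontier \<Omega>" for x
    using surface_measure_lower_density[OF \<Omega>(1,3) dt normal that] unfolding c_def \<omega>_def by metis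
  obtain C r where C: "finite C" "\<And>x. x \<in> C \<Longrightarrow> x \<in> frontier \<Omega>" "\<And>x. x \<in> C \<Longrightarrow> 0 < r x" "\<And>x. x \<in> C \<Longrightarrow> r x < \<rho>"
    "frontier \<Omega> \<subseteq> (\<Union>x\<in>C. ball x (6 * r x))" "c * (\<Sum>x\<in>C. r x ^ (?n - 1)) \<le> P"
    unfolding P_def by (rule small_ball_cover[OF compact(2) sigma(2,1) c density \<rho>(1)]) (assumption, blast)
  obtain \<psi> \<psi>' where \<psi>: "\<And>y. (\<psi> has_derivative \<psi>' y) (at y)" "\<And>h. continuous_on UNIV (\<lambda>y. \<psi>' y h)"
    "\<And>y. 0 \<le> \<psi> y \<and> \<psi> y \<le> (1::real)" "\<And>y. y \<in> (\<Union>x\<in>C. ball x (6 * r x)) \<Longrightarrow> \<psi> y = 0"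
    "\<And>y. 1 - \<psi> y \<le> (\<Sum>x\<in>C. indicator (ball x (2 * (6 * r x))) y)"
    "\<And>y h. \<bar>\<psi>' y h\<bar> \<le> (\<Sum>x\<in>C. 6 / (6 * r x) * indicator (ball x (2 * (6 * r x))) y) * norm h"
    by (rule finite_balls_cutoff[OF C(1), of "\<lambda>x. 6 * r x"]) (use C(3) in simp, blast)
  have C1\<psi>: "C1_on S \<psi>" for S using C1_on_subset[OF C1_onI[OF \<psi>(1,2)]] by blast

  define W where "W y = (if y \<in> \<Omega> then G y + \<psi> y *\<^sub>R (F y - G y) else G y)" for y
  have C1W': "C1_on \<Omega> (\<lambda>y. G y + \<psi> y *\<^sub>R (F y - G y))"
    by (intro C1_on_add C1_on_scaleR C1_on_diff C1G C1\<psi> C1)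
  have C1W: "C1_on UNIV W"
  proof -
    let ?U = "(\<Union>x\<in>C. ball x (6 * r x)) \<union> - closure \<Omega>"
    have "C1_on \<Omega> W"
      by (rule C1_on_cong[OF \<Omega>(1) C1W']) (simp add: W_def)
    moreover have "C1_on ?U W"
    proof (rule C1_on_cong[OF _ C1G])
      show "open ?U" by blast
      show "G y = W y" if "y \<in> ?U" for y
        using that \<psi>(4)[of y] closure_subset[of \<Omega>] by (auto simp: W_def)
    qed
    moreover have "\<Omega> \<union> ?U = UNIV"
      using C(5) \<Omega>(1) by (auto simp: frontier_def interior_open)
    ultimately show ?thesis using C1_on_open_Un[of \<Omega> ?U W] \<Omega>(1) by auto
  qed
  have divW: "divergence W y = (1 - \<psi> y) * divergence G y + \<psi> y * divergence F y + \<psi>' y (F y - G y)"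
    if y: "y \<in> \<Omega>" for y
  proof -
    have diff: "F differentiable (at y)" "G differentiable (at y)"
      using C1_on_imp_differentiable y C1 C1G by blast+
    have "divergence W y = divergence (\<lambda>y. G y + \<psi> y *\<^sub>R (F y - G y)) y"
      by (rule divergence_cong_open[OF \<Omega>(1) y])
        (auto simp: W_def intro: C1_on_imp_differentiable[OF C1W' y])
    also have "\<dots> = divergence G y + (\<psi>' y (F y - G y) + \<psi> y * (divergence F y - divergence G y))"
      using diff \<psi>(1)[of y]
      by (subst divergence_add)
        (auto simp: divergence_scaleR[OF \<psi>(1)] divergence_diff differentiable_def[of \<psi>]
          intro!: differentiable_scaleR differentiable_diff)
    finally show ?thesis by (simp add: algebra_simps)
  qed
  define b where "b y = - c\<^sub>0 * indicator ?K y + (\<Sum>x\<in>C. (M + \<delta> / r x) * indicator (ball x (12 * r x)) y)"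
    for y :: "real^'n"
  have coeff: "0 \<le> M + \<delta> / r x" if "x \<in> C" for x using M(1) \<delta> C(3)[OF that] by simp
  have pointwise: "indicator \<Omega> y * divergence W y \<le> b y" for y
  proof (cases "y \<in> \<Omega>")
    case False
    then have "y \<notin> ?K" using K by blast
    moreover have "0 \<le> (\<Sum>x\<in>C. (M + \<delta> / r x) * indicator (ball x (12 * r x)) y)"
      by (intro sum_nonneg mult_nonneg_nonneg coeff) auto
    ultimately show ?thesis using False by (simp add: b_def)
  next
    case True
    then have yc: "y \<in> closure \<Omega>" using closure_subset by blast
    have 1: "(1 - \<psi> y) * divergence G y \<le> (\<Sum>x\<in>C. indicator (ball x (12 * r x)) y) * M"
    proof -
      have "(1 - \<psi> y) * divergence G y \<le> (1 - \<psi> y) * M"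
        using \<psi>(3)[of y] M(2)[OF yc] by (intro mult_left_mono) auto
      also have "\<dots> \<le> (\<Sum>x\<in>C. indicator (ball x (12 * r x)) y) * M"
        using \<psi>(5)[of y] M(1) by (intro mult_right_mono) auto
      finally show ?thesis .
    qed
    have 2: "\<psi> y * divergence F y \<le> - c\<^sub>0 * indicator ?K y"
    proof (cases "y \<in> ?K")
      case True
      have "y \<notin> ball x (12 * r x)" if x: "x \<in> C" for x
      proof
        assume "y \<in> ball x (12 * r x)"
        then have "dist x y < \<rho>\<^sub>0" using C(4)[OF x] \<rho>(2) by simp
        then have "dist x\<^sub>0 x < \<rho>\<^sub>2"
          using True dist_triangle[of "x\<^sub>0" x y] by (simp add: dist_commute \<rho>\<^sub>0_def)
        then have "x \<in> \<Omega>" using \<rho>2(2) by auto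
        then show False using C(2)[OF x] \<Omega>(1) by (simp add: frontier_def interior_open)
      qed
      then have "(\<Sum>x\<in>C. indicator (ball x (12 * r x)) y) = (0::real)" by (intro sum.neutral) auto
      then have "\<psi> y = 1" using \<psi>(3,5)[of y] by simp
      then show ?thesis using Kdiv[OF True] True by simp
    next
      case False
      then show ?thesis using \<psi>(3)[of y] neg[OF \<open>y \<in> \<Omega>\<close>] by (simp add: mult_nonneg_nonpos)
    qed
    have 3: "\<psi>' y (F y - G y) \<le> (\<Sum>x\<in>C. 1 / r x * indicator (ball x (12 * r x)) y) * \<delta>"
    proof -
      have s0: "0 \<le> (\<Sum>x\<in>C. 1 / r x * indicator (ball x (12 * r x)) y)"
        by (intro sum_nonneg mult_nonneg_nonneg) (auto simp: C(3) less_imp_le)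
      have "\<psi>' y (F y - G y) \<le> (\<Sum>x\<in>C. 1 / r x * indicator (ball x (12 * r x)) y) * norm (F y - G y)"
        using \<psi>(6)[of y "F y - G y"] by simp
      also have "\<dots> \<le> (\<Sum>x\<in>C. 1 / r x * indicator (ball x (12 * r x)) y) * \<delta>"
        using G(2)[OF yc] s0 by (intro mult_left_mono) auto
      finally show ?thesis .
    qed
    have "b y = - c\<^sub>0 * indicator ?K y + (\<Sum>x\<in>C. indicator (ball x (12 * r x)) y) * M
        + (\<Sum>x\<in>C. 1 / r x * indicator (ball x (12 * r x)) y) * \<delta>"
      by (simp add: b_def sum_distrib_left sum_distrib_right sum.distrib algebra_simps)
    then show ?thesis using 1 2 3 divW[OF True] True by simp
  qed
  have intB: "integrable lborel (\<lambda>y::real^'n. k * indicator (ball a s) y :: real)" for a s k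
    by (intro integrable_mult_right integrable_real_indicator) (use emeasure_lborel_ball_finite in auto)

  have "- (\<delta> * P) \<le> (LINT y:frontier \<Omega>|\<sigma>. W y \<bullet> \<nu> y)"
  proof -
    have fr: "frontier \<Omega> \<in> sets \<sigma>" using sigma by simp
    have "- (\<delta> * P) = (LINT y|\<sigma>. - \<delta> * indicator (frontier \<Omega>) y)"
      using fr by (simp add: P_def)
    also have "\<dots> \<le> (LINT y:frontier \<Omega>|\<sigma>. W y \<bullet> \<nu> y)"
      unfolding set_lebesgue_integral_def
    proof (rule integral_mono)
      show "integrable \<sigma> (\<lambda>y. indicator (frontier \<Omega>) y *\<^sub>R (W y \<bullet> \<nu> y))"
        using dt C1W by (auto simp add: divergence_theorem_def set_integrable_def)
      show "integrable \<sigma> (\<lambda>y. - \<delta> * indicat_real (frontier \<Omega>) y)"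
        using fr by (intro integrable_mult_right integrable_real_indicator) (auto simp: less_top[symmetric])
      show "- \<delta> * indicat_real (frontier \<Omega>) y \<le> indicator (frontier \<Omega>) y *\<^sub>R (W y \<bullet> \<nu> y)" for y
      proof (cases "y \<in> frontier \<Omega>")
        case True
        then have "y \<notin> \<Omega>" "y \<in> closure \<Omega>" using \<Omega>(1) by (auto simp: frontier_def interior_open)
        then have "norm (F y - G y) < \<delta>" "W y = G y" using G(2) by (auto simp: W_def)
        moreover have "norm (\<nu> y) = 1" using normal[OF True] by (auto simp: outward_unit_normal_def)
        ultimately have "(F y - G y) \<bullet> \<nu> y \<le> \<delta>"
          using norm_cauchy_schwarz[of "F y - G y" "\<nu> y"] by simp
        then show ?thesis using flux[OF True] True \<open>W y = G y\<close> by (simp add: inner_diff_left)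
      qed simp
    qed
    finally show ?thesis .
  qed
  also have "\<dots> = (LINT y:\<Omega>|lborel. divergence W y)"
    using dt C1W by (simp add: divergence_theorem_def)
  also have "\<dots> \<le> (LINT y|lborel. b y)"
    unfolding set_lebesgue_integral_def
  proof (rule integral_mono)
    show "integrable lborel (\<lambda>y. indicator \<Omega> y *\<^sub>R divergence W y)"
      using set_integrable_divergence[OF C1W \<Omega>(1,3)] by (simp add: set_integrable_def)
    show "integrable lborel b"
      unfolding b_def[abs_def] by (intro Bochner_Integration.integrable_add Bochner_Integration.integrable_sum intB)
  qed (use pointwise in auto)
  also have "\<dots> = - c\<^sub>0 * V + (\<Sum>x\<in>C. (M + \<delta> / r x) * measure lborel (ball x (12 * r x)))"
  proof -
    have "(LINT y|lborel. k * indicator (ball a s) y) = k * measure lborel (ball a s)"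
      for k s and a :: "real^'n"
      by simp
    then show ?thesis
      unfolding b_def[abs_def] V_def
        Bochner_Integration.integral_add[OF intB Bochner_Integration.integrable_sum[OF intB]]
        Bochner_Integration.integral_sum[OF intB]
      by presburger
  qed
  also have "(\<Sum>x\<in>C. (M + \<delta> / r x) * measure lborel (ball x (12 * r x)))
      = (\<Sum>x\<in>C. (M * r x + \<delta>) * (\<omega> * 12 ^ ?n * r x ^ (?n - 1)))"
  proof (rule sum.cong[OF refl])
    fix x assume x: "x \<in> C"
    have "r x ^ ?n = r x * r x ^ (?n - 1)" by (simp flip: power_Suc)
    then have "(M + \<delta> / r x) * measure lborel (ball x (12 * r x))
        = ((M + \<delta> / r x) * r x) * (\<omega> * 12 ^ ?n * r x ^ (?n - 1))"
      using C(3)[OF x] by (simp only: vol power_mult_distrib zero_less_mult_iff zero_less_numeral simp_thms mult_ac)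
    also have "(M + \<delta> / r x) * r x = M * r x + \<delta>"
      using C(3)[OF x] by (simp add: distrib_right)
    finally show "(M + \<delta> / r x) * measure lborel (ball x (12 * r x)) = (M * r x + \<delta>) * (\<omega> * 12 ^ ?n * r x ^ (?n - 1))" .
  qed
  also have "\<dots> \<le> (\<Sum>x\<in>C. 2 * \<delta> * (\<omega> * 12 ^ ?n * r x ^ (?n - 1)))"
  proof (rule sum_mono)
    fix x assume x: "x \<in> C"
    have "M * r x \<le> M * \<rho>" using M(1) C(4)[OF x] by simp
    then show "(M * r x + \<delta>) * (\<omega> * 12 ^ ?n * r x ^ (?n - 1)) \<le> 2 * \<delta> * (\<omega> * 12 ^ ?n * r x ^ (?n - 1))"
      using \<rho>(3) \<omega> C(3)[OF x] by (intro mult_right_mono) auto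
  qed
  also have "\<dots> = 2 * \<delta> * (\<omega> * 12 ^ ?n) * (\<Sum>x\<in>C. r x ^ (?n - 1))"
    by (simp add: sum_distrib_left mult_ac)
  also have "\<dots> \<le> 2 * \<delta> * (\<omega> * 12 ^ ?n) * (P / c)"
  proof (rule mult_left_mono)
    show "(\<Sum>x\<in>C. r x ^ (?n - 1)) \<le> P / c" using C(6) c by (simp add: pos_le_divide_eq mult.commute)
  qed (use \<delta> \<omega> in simp)
  also have "2 * \<delta> * (\<omega> * 12 ^ ?n) * (P / c) = 2 * (\<delta> * A)"
    by (simp only: A_def mult.assoc)
  finally have "c\<^sub>0 * V \<le> 2 * (\<delta> * A) + \<delta> * P" by simp
  also have "\<dots> = \<delta> * (2 * A + P)" by (simp only: distrib_left mult.left_commute)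
  also have "\<dots> \<le> \<delta> * (2 * (A + P + 1))" using \<delta> A P by (intro mult_left_mono) auto
  also have "\<dots> = c\<^sub>0 * V / 2"
  proof -
    have "c\<^sub>0 * V / (4 * B) * (2 * B) = c\<^sub>0 * V / 2" if "B > 0" for B
      using that by simp
    from this[of "A + P + 1"] show ?thesis unfolding \<delta>_def using A P by fastforce
  qed
  finally show False using mult_pos_pos[OF c0 V] by linarith
qed

section \<open>Gradients of solutions\<close>

text \<open>The left-hand side is an increment of \<open>s \<mapsto> f(x + ta + stb) - f(x + stb)\<close> over the unit interval.  The mean
  value theorem turns it into a difference of gradients, which the derivative of \<open>g\<close> at \<open>x\<close> approximates to
  first order.\<close>

lemma second_difference:
  fixes f :: "'a::real_inner \<Rightarrow> real"
  assumes "open S" "x \<in> S" and f: "\<And>y. y \<in> S \<Longrightarrow> (f has_derivative (\<lambda>h. g y \<bullet> h)) (at y)"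
    and g: "(g has_derivative D) (at x)" and e: "e > 0"
  shows "\<exists>d>0. \<forall>t. 0 < t \<and> t < d \<longrightarrow>
    \<bar>f (x + t *\<^sub>R a + t *\<^sub>R b) - f (x + t *\<^sub>R a) - f (x + t *\<^sub>R b) + f x - t\<^sup>2 * (D a \<bullet> b)\<bar> \<le> e * t\<^sup>2"
proof -
  interpret D: bounded_linear D using g by (rule has_derivative_bounded_linear)
  define c where "c = (norm a + 2 * norm b) * norm b + 1"
  have c: "c > 0" by (simp add: c_def add_nonneg_pos)
  define e' where "e' = e / c"
  have e': "e' > 0" using e c by (simp add: e'_def)
  obtain d1 where d1: "d1 > 0" "\<And>y. norm (y - x) < d1 \<Longrightarrow> norm (g y - g x - D (y - x)) \<le> e' * norm (y - x)"
    using g e' unfolding has_derivative_at_alt by blast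
  obtain d2 where d2: "d2 > 0" "ball x d2 \<subseteq> S" using assms(1,2) open_contains_ball by blast
  define d where "d = min d1 d2 / (norm a + norm b + 1)"
  have ab: "norm a + norm b + 1 > 0" by (simp add: add_nonneg_pos)
  have "d > 0" using d1 d2 ab by (simp add: d_def)
  moreover have "\<bar>f (x + t *\<^sub>R a + t *\<^sub>R b) - f (x + t *\<^sub>R a) - f (x + t *\<^sub>R b) + f x - t\<^sup>2 * (D a \<bullet> b)\<bar> \<le> e * t\<^sup>2"
    if t: "0 < t" "t < d" for t
  proof -
    have small: "t * (norm a + norm b) < min d1 d2"
    proof -
      have "t * (norm a + norm b) \<le> t * (norm a + norm b + 1)" using t by simp
      also have "\<dots> < min d1 d2" using t ab by (simp add: d_def pos_less_divide_eq)
      finally show ?thesis .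
    qed
    have n: "norm (t *\<^sub>R a + (s * t) *\<^sub>R b) \<le> t * (norm a + norm b)" "norm ((s * t) *\<^sub>R b) \<le> t * norm b"
      if "0 \<le> s" "s \<le> 1" for s
    proof -
      show 1: "norm ((s * t) *\<^sub>R b) \<le> t * norm b"
        using that t by (simp add: abs_mult mult_right_mono mult_left_le_one_le)
      show "norm (t *\<^sub>R a + (s * t) *\<^sub>R b) \<le> t * (norm a + norm b)"
        using norm_triangle_ineq[of "t *\<^sub>R a" "(s * t) *\<^sub>R b"] 1 t by (simp add: distrib_left)
    qed
    have tb: "t * norm b \<le> t * (norm a + norm b)" using t by simp
    have near: "norm (t *\<^sub>R a + (s * t) *\<^sub>R b) < min d1 d2" "norm ((s * t) *\<^sub>R b) < min d1 d2"
      if "0 \<le> s" "s \<le> 1" for s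
      using n[OF that] small tb by linarith+
    define \<psi> where "\<psi> s = f (x + t *\<^sub>R a + (s * t) *\<^sub>R b) - f (x + (s * t) *\<^sub>R b)" for s
    define \<psi>' where "\<psi>' s = (g (x + t *\<^sub>R a + (s * t) *\<^sub>R b) - g (x + (s * t) *\<^sub>R b)) \<bullet> (t *\<^sub>R b)" for s
    have "DERIV \<psi> s :> \<psi>' s" if s: "0 \<le> s" "s \<le> 1" for s
    proof -
      have inS: "x + t *\<^sub>R a + (s * t) *\<^sub>R b \<in> S" "x + (s * t) *\<^sub>R b \<in> S"
        using near[OF s] d2(2) by (auto simp: dist_norm subset_iff add.assoc norm_minus_commute)
      have lin: "((\<lambda>s. p + (s * t) *\<^sub>R b) has_derivative (\<lambda>k. (k * t) *\<^sub>R b)) (at s)" for p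
        by (auto intro!: derivative_eq_intros)
      have "(\<psi> has_derivative (\<lambda>k. g (x + t *\<^sub>R a + (s * t) *\<^sub>R b) \<bullet> ((k * t) *\<^sub>R b)
          - g (x + (s * t) *\<^sub>R b) \<bullet> ((k * t) *\<^sub>R b))) (at s)"
        unfolding \<psi>_def[abs_def]
        by (intro has_derivative_diff has_derivative_compose[OF lin f] inS)
      moreover have "(\<lambda>k. g (x + t *\<^sub>R a + (s * t) *\<^sub>R b) \<bullet> ((k * t) *\<^sub>R b)
          - g (x + (s * t) *\<^sub>R b) \<bullet> ((k * t) *\<^sub>R b)) = (*) (\<psi>' s)"
        by (auto simp: \<psi>'_def inner_diff_left algebra_simps)
      ultimately show ?thesis by (simp add: has_field_derivative_def)
    qed
    then obtain s where s: "0 < s" "s < 1" "\<psi> 1 - \<psi> 0 = (1 - 0) * \<psi>' s"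
      using MVT2[of 0 1 \<psi> \<psi>'] by auto
    define y1 where "y1 = x + t *\<^sub>R a + (s * t) *\<^sub>R b"
    define y2 where "y2 = x + (s * t) *\<^sub>R b"
    have y: "norm (y1 - x) < d1" "norm (y2 - x) < d1"
      "norm (y1 - x) \<le> t * (norm a + norm b)" "norm (y2 - x) \<le> t * norm b"
      using near[of s] n[of s] s by (auto simp: y1_def y2_def add.assoc)
    have "D (y1 - x) - D (y2 - x) = t *\<^sub>R D a"
      by (simp add: y1_def y2_def D.add D.scaleR flip: D.diff)
    then have "g y1 - g y2 - t *\<^sub>R D a = (g y1 - g x - D (y1 - x)) - (g y2 - g x - D (y2 - x))"
      by (simp add: algebra_simps)
    also have "norm \<dots> \<le> norm (g y1 - g x - D (y1 - x)) + norm (g y2 - g x - D (y2 - x))"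
      by (rule norm_triangle_ineq4)
    also have "\<dots> \<le> e' * norm (y1 - x) + e' * norm (y2 - x)"
      using d1(2) y by (intro add_mono) auto
    also have "\<dots> \<le> e' * (t * (norm a + norm b)) + e' * (t * norm b)"
      using y e' by (intro add_mono mult_left_mono) auto
    also have "\<dots> = e' * t * (norm a + 2 * norm b)" by (simp add: algebra_simps)
    finally have ng: "norm (g y1 - g y2 - t *\<^sub>R D a) \<le> e' * t * (norm a + 2 * norm b)" .
    have "f (x + t *\<^sub>R a + t *\<^sub>R b) - f (x + t *\<^sub>R a) - f (x + t *\<^sub>R b) + f x = \<psi> 1 - \<psi> 0"
      by (simp add: \<psi>_def)
    then have "f (x + t *\<^sub>R a + t *\<^sub>R b) - f (x + t *\<^sub>R a) - f (x + t *\<^sub>R b) + f x - t\<^sup>2 * (D a \<bullet> b)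
        = t * ((g y1 - g y2 - t *\<^sub>R D a) \<bullet> b)"
      using s(3) by (simp add: \<psi>'_def y1_def y2_def inner_diff_left power2_eq_square algebra_simps)
    also have "\<bar>\<dots>\<bar> \<le> t * (norm (g y1 - g y2 - t *\<^sub>R D a) * norm b)"
      using t Cauchy_Schwarz_ineq2 by (simp add: abs_mult)
    also have "\<dots> \<le> t * (e' * t * (norm a + 2 * norm b) * norm b)"
      using t ng by (intro mult_left_mono mult_right_mono) auto
    also have "\<dots> = e' * ((norm a + 2 * norm b) * norm b) * t\<^sup>2"
      by (simp only: power2_eq_square mult_ac)
    also have "\<dots> \<le> e' * c * t\<^sup>2"
      using e' by (intro mult_right_mono mult_left_mono) (auto simp: c_def)
    also have "\<dots> = e * t\<^sup>2" using c by (simp add: e'_def)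
    finally show ?thesis .
  qed
  ultimately show ?thesis by blast
qed

text \<open>The second difference is symmetric in \<open>a\<close> and \<open>b\<close>, while it is approximated by \<open>t\<^sup>2\<close> times either of the two
  mixed derivatives.\<close>

lemma hessian_symmetric:
  fixes f :: "'a::real_inner \<Rightarrow> real"
  assumes S: "open S" "x \<in> S" and f: "\<And>y. y \<in> S \<Longrightarrow> (f has_derivative (\<lambda>h. g y \<bullet> h)) (at y)"
    and g: "(g has_derivative D) (at x)"
  shows "D a \<bullet> b = D b \<bullet> a"
proof (rule ccontr)
  assume ne: "D a \<bullet> b \<noteq> D b \<bullet> a"
  define e where "e = \<bar>D a \<bullet> b - D b \<bullet> a\<bar> / 4"
  have e: "e > 0" using ne by (simp add: e_def)
  let ?\<Delta> = "\<lambda>t a b. f (x + t *\<^sub>R a + t *\<^sub>R b) - f (x + t *\<^sub>R a) - f (x + t *\<^sub>R b) + f x"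
  obtain d1 where d1: "d1 > 0" "\<And>t. 0 < t \<Longrightarrow> t < d1 \<Longrightarrow> \<bar>?\<Delta> t a b - t\<^sup>2 * (D a \<bullet> b)\<bar> \<le> e * t\<^sup>2"
    using second_difference[OF S f g e, of a b] by blast
  obtain d2 where d2: "d2 > 0" "\<And>t. 0 < t \<Longrightarrow> t < d2 \<Longrightarrow> \<bar>?\<Delta> t b a - t\<^sup>2 * (D b \<bullet> a)\<bar> \<le> e * t\<^sup>2"
    using second_difference[OF S f g e, of b a] by blast
  define t where "t = min d1 d2 / 2"
  have t: "0 < t" "t < d1" "t < d2" using d1(1) d2(1) by (auto simp: t_def)
  have "?\<Delta> t a b = ?\<Delta> t b a" by (simp add: add_ac)
  then have "\<bar>t\<^sup>2 * (D a \<bullet> b) - t\<^sup>2 * (D b \<bullet> a)\<bar> \<le> 2 * e * t\<^sup>2"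
    using d1(2)[OF t(1,2)] d2(2)[OF t(1,3)] by linarith
  moreover have "\<bar>t\<^sup>2 * (D a \<bullet> b) - t\<^sup>2 * (D b \<bullet> a)\<bar> = t\<^sup>2 * (4 * e)"
    by (simp add: e_def abs_mult flip: right_diff_distrib)
  ultimately have "t\<^sup>2 * (4 * e) \<le> t\<^sup>2 * (2 * e)" by simp
  then show False using t e by simp
qed

text \<open>The two regularity classes provide two derivatives, one that is continuously differentiable inside
  and one that is continuous up to the boundary.  They agree inside, so a single gradient field has both
  properties.\<close>

lemma gradient_field:
  fixes f :: "real^'n \<Rightarrow> real"
  assumes \<Omega>: "open \<Omega>" and C2: "C2_on \<Omega> f" and C1: "C1_closure \<Omega> f"
  obtains g where "continuous_on (closure \<Omega>) g" "C1_on \<Omega> g"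
    "\<And>x. x \<in> \<Omega> \<Longrightarrow> (f has_derivative (\<lambda>h. g x \<bullet> h)) (at x)"
    "\<And>x. x \<in> \<Omega> \<Longrightarrow> divergence g x = laplacian f x"
proof -
  obtain f' where f': "\<And>x. x \<in> \<Omega> \<Longrightarrow> (f has_derivative blinfun_apply (f' x)) (at x)" "C1_on \<Omega> f'"
    using C2 unfolding C2_on_def by blast
  obtain f'' where f'': "\<And>x. x \<in> \<Omega> \<Longrightarrow> (f has_derivative blinfun_apply (f'' x)) (at x)"
    "continuous_on (closure \<Omega>) f''"
    using C1 unfolding C1_closure_def by blast
  have eq: "blinfun_apply (f'' x) = blinfun_apply (f' x)" if "x \<in> \<Omega>" for x
    using has_derivative_unique f'(1) f''(1) that by blast
  define g where "g x = (\<Sum>i\<in>UNIV. blinfun_apply (f'' x) (axis i 1) *\<^sub>R axis i (1::real))" for x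
  have gi: "g x $ i = blinfun_apply (f'' x) (axis i 1)" for x i
    by (simp add: g_def axis_def if_distrib cong: if_cong)
  have deriv: "(f has_derivative (\<lambda>h. g x \<bullet> h)) (at x)" if "x \<in> \<Omega>" for x
  proof -
    have "g x \<bullet> h = blinfun_apply (f'' x) h" for h
      using linear_eq_sum_axis[OF bounded_linear.linear[OF blinfun.bounded_linear_right], of h "f'' x"]
      by (simp add: inner_vec_def gi mult.commute)
    then show ?thesis using f''(1)[OF that] by simp
  qed
  have C1g: "C1_on \<Omega> g"
  proof (rule C1_on_cong[OF \<Omega>])
    show "C1_on \<Omega> (\<lambda>x. \<Sum>i\<in>UNIV. blinfun_apply (f' x) (axis i 1) *\<^sub>R axis i (1::real))"
      by (intro C1_on_sum C1_on_scaleR C1_on_bilinear[OF bounded_bilinear_blinfun_apply] f'(2) C1_on_const)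
  qed (simp add: g_def eq)
  show ?thesis
  proof (rule that[OF _ C1g deriv])
    show "continuous_on (closure \<Omega>) g"
      unfolding g_def by (intro continuous_intros f''(2))
    show "divergence g x = laplacian f x" if x: "x \<in> \<Omega>" for x
      unfolding divergence_def laplacian_def
    proof (rule sum.cong[OF refl])
      fix i :: 'n
      obtain D where D: "(g has_derivative D) (at x)"
        using C1_on_imp_differentiable[OF C1g x] unfolding differentiable_def by blast
      have Di: "((\<lambda>y. g y $ i) has_derivative (\<lambda>h. D h $ i)) (at x)"
        by (rule bounded_linear.has_derivative[OF bounded_linear_vec_nth D])
      have "g y $ i = dderiv (axis i 1) f y" if "y \<in> \<Omega>" for y
        using dderiv_eq[OF f''(1)[OF that]] by (simp add: gi)
      then have "(dderiv (axis i 1) f has_derivative (\<lambda>h. D h $ i)) (at x)"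
        using has_derivative_transform_within_open[OF Di \<Omega> x] by blast
      then show "dderiv (axis i 1) (\<lambda>y. g y $ i) x = dderiv (axis i 1) (dderiv (axis i 1) f) x"
        using dderiv_eq Di by metis
    qed
  qed
qed

text \<open>Every segment that leaves \<open>x\<close> in a direction \<open>d\<close> with \<open>d \<bullet> w < 0\<close> starts inside \<open>\<Omega>\<close>, and \<open>f\<close> is positive
  along it but zero at \<open>x\<close>; hence \<open>g x \<bullet> d \<ge> 0\<close>.  A vector that is nonnegative on an open half-space is a
  multiple of its normal, with the sign stated.  Only the one-sided limit of the gradient at \<open>x\<close> enters, since
  \<open>f\<close> is not assumed differentiable there.\<close>

lemma boundary_gradient:
  fixes f :: "'a::real_inner \<Rightarrow> real"
  assumes normal: "outward_unit_normal \<Omega> x w" and x: "x \<in> closure \<Omega>"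
    and f: "continuous_on (closure \<Omega>) f" and g: "continuous_on (closure \<Omega>) g"
    and deriv: "\<And>y. y \<in> \<Omega> \<Longrightarrow> (f has_derivative (\<lambda>h. g y \<bullet> h)) (at y)"
    and pos: "\<And>y. y \<in> \<Omega> \<Longrightarrow> 0 < f y" and "f x = 0"
  obtains c where "c \<le> 0" "g x = c *\<^sub>R w"
proof -
  have w: "norm w = 1" using normal by (simp add: outward_unit_normal_def)
  have inward: "0 \<le> g x \<bullet> d" if d: "d \<bullet> w < 0" for d
  proof (rule ccontr)
    assume "\<not> ?thesis"
    then have neg: "g x \<bullet> d < 0" by simp
    have nd: "norm d > 0" using d by auto
    define \<epsilon> where "\<epsilon> = - (d \<bullet> w) / (2 * norm d)"
    have \<epsilon>: "\<epsilon> > 0" using d nd unfolding \<epsilon>_def by (intro divide_pos_pos) auto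
    obtain \<delta> where \<delta>: "\<delta> > 0" "\<And>y. y \<in> ball x \<delta> \<Longrightarrow> (y - x) \<bullet> w < - \<epsilon> * norm (y - x) \<Longrightarrow> y \<in> \<Omega>"
      using normal \<epsilon> unfolding outward_unit_normal_def by meson
    have "continuous_on (closure \<Omega>) (\<lambda>y. g y \<bullet> d)" by (intro continuous_intros g)
    then obtain \<delta>' where \<delta>': "\<delta>' > 0" "\<And>y. y \<in> closure \<Omega> \<Longrightarrow> dist y x < \<delta>' \<Longrightarrow> dist (g y \<bullet> d) (g x \<bullet> d) < - (g x \<bullet> d)"
      using neg x unfolding continuous_on_iff by (metis neg_0_less_iff_less)
    define T where "T = min \<delta> \<delta>' / (2 * norm d)"
    have T: "T > 0" using \<delta> \<delta>' nd by (simp add: T_def)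
    have Td: "T * norm d < \<delta>" "T * norm d < \<delta>'" using \<delta>(1) \<delta>'(1) nd by (auto simp: T_def)
    have seg: "x + t *\<^sub>R d \<in> \<Omega>" "g (x + t *\<^sub>R d) \<bullet> d < 0" if t: "0 < t" "t \<le> T" for t
    proof -
      have le: "t * norm d \<le> T * norm d" using t nd by simp
      have "t * (d \<bullet> w) < - \<epsilon> * (t * norm d)"
        using t d nd by (simp add: \<epsilon>_def)
      then show *: "x + t *\<^sub>R d \<in> \<Omega>"
        using le Td t by (intro \<delta>(2)) (auto simp: dist_norm)
      have "dist (g (x + t *\<^sub>R d) \<bullet> d) (g x \<bullet> d) < - (g x \<bullet> d)"
        using le Td t * closure_subset[of \<Omega>] by (intro \<delta>'(2)) (auto simp: dist_norm)
      then show "g (x + t *\<^sub>R d) \<bullet> d < 0" by (simp add: dist_real_def)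
    qed
    have inclosure: "x + t *\<^sub>R d \<in> closure \<Omega>" if "t \<in> {0..T}" for t
    proof (cases "t = 0")
      case False
      then show ?thesis using seg(1)[of t] that closure_subset by fastforce
    qed (use x in simp)
    have cont: "continuous_on {0..T} (\<lambda>t. f (x + t *\<^sub>R d))"
      by (rule continuous_on_compose2[OF f]) (use inclosure in \<open>auto intro!: continuous_intros\<close>)
    have deriv_seg: "((\<lambda>t. f (x + t *\<^sub>R d)) has_derivative (\<lambda>k. g (x + t *\<^sub>R d) \<bullet> (k *\<^sub>R d))) (at t)"
      if t: "0 < t" "t < T" for t
    proof (rule has_derivative_compose[OF _ deriv])
      show "((\<lambda>t. x + t *\<^sub>R d) has_derivative (\<lambda>k. k *\<^sub>R d)) (at t)"
        by (auto intro!: derivative_eq_intros)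
    qed (use seg t in simp)
    obtain s where s: "0 < s" "s < T" "f (x + T *\<^sub>R d) - f (x + 0 *\<^sub>R d) = g (x + s *\<^sub>R d) \<bullet> ((T - 0) *\<^sub>R d)"
      by (rule mvt[OF T cont deriv_seg])
    have "f (x + T *\<^sub>R d) > 0" using seg(1)[of T] T pos by simp
    moreover have "g (x + s *\<^sub>R d) \<bullet> ((T - 0) *\<^sub>R d) < 0"
      using seg(2)[of s] s T by (simp add: mult_pos_neg)
    ultimately show False using s(3) \<open>f x = 0\<close> by simp
  qed
  \<comment> \<open>The tangential part \<open>v\<close> vanishes: test with the inward direction \<open>- v - s *\<^sub>R w\<close> for small \<open>s\<close>.\<close>
  define v where "v = g x - (g x \<bullet> w) *\<^sub>R w"
  have ww: "w \<bullet> w = 1" using w by (simp add: dot_square_norm)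
  have vw: "v \<bullet> w = 0" by (simp add: v_def inner_diff_left ww)
  have gv: "g x \<bullet> v = v \<bullet> v"
  proof -
    have "g x = v + (g x \<bullet> w) *\<^sub>R w" by (simp add: v_def)
    then show ?thesis using vw by (metis inner_add_left inner_commute inner_scaleR_left mult_zero_right add.right_neutral)
  qed
  have nonpos: "g x \<bullet> w \<le> 0" using inward[of "- w"] by (simp add: ww)
  have "v = 0"
  proof (rule ccontr)
    assume "v \<noteq> 0"
    then have vv: "v \<bullet> v > 0" by simp
    define s where "s = v \<bullet> v / (2 * (\<bar>g x \<bullet> w\<bar> + 1))"
    have s: "s > 0" using vv by (simp add: s_def)
    have "0 \<le> g x \<bullet> (- v - s *\<^sub>R w)"
      using s by (intro inward) (simp add: inner_diff_left vw ww)
    then have "v \<bullet> v \<le> s * \<bar>g x \<bullet> w\<bar>"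
      using nonpos by (simp add: inner_diff_right gv)
    also have "\<dots> \<le> s * (\<bar>g x \<bullet> w\<bar> + 1)" using s by simp
    also have "\<dots> = v \<bullet> v / 2"
    proof -
      have "v \<bullet> v / (2 * c) * c = v \<bullet> v / 2" if "c > 0" for c
        using that by simp
      from this[of "\<bar>g x \<bullet> w\<bar> + 1"] show ?thesis unfolding s_def by fastforce
    qed
    finally show False using vv by simp
  qed
  then show ?thesis using that[OF nonpos] by (simp add: v_def)
qed

section \<open>The Pohozaev identity and nonexistence\<close>

text \<open>Rellich's bilinear identity for two gradient fields.  The terms with derivatives of the fields in
  the direction \<open>x\<close> cancel because the Hessians are symmetric.\<close>

lemma rellich_divergence:
  fixes g\<^sub>1 g\<^sub>2 :: "real^'n \<Rightarrow> real^'n"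
  assumes 1: "(g\<^sub>1 has_derivative D\<^sub>1) (at x)" "\<And>a b. D\<^sub>1 a \<bullet> b = D\<^sub>1 b \<bullet> a"
    and 2: "(g\<^sub>2 has_derivative D\<^sub>2) (at x)" "\<And>a b. D\<^sub>2 a \<bullet> b = D\<^sub>2 b \<bullet> a"
  shows "divergence (\<lambda>y. (y \<bullet> g\<^sub>1 y) *\<^sub>R g\<^sub>2 y + (y \<bullet> g\<^sub>2 y) *\<^sub>R g\<^sub>1 y - (g\<^sub>1 y \<bullet> g\<^sub>2 y) *\<^sub>R y) x
    = (2 - real CARD('n)) * (g\<^sub>1 x \<bullet> g\<^sub>2 x) + (x \<bullet> g\<^sub>1 x) * divergence g\<^sub>2 x + (x \<bullet> g\<^sub>2 x) * divergence g\<^sub>1 x"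
proof -
  have diff: "g\<^sub>1 differentiable (at x)" "g\<^sub>2 differentiable (at x)"
    using 1(1) 2(1) by (auto simp: differentiable_def)
  have i1: "((\<lambda>y. y \<bullet> g\<^sub>1 y) has_derivative (\<lambda>h. x \<bullet> D\<^sub>1 h + h \<bullet> g\<^sub>1 x)) (at x)"
    by (rule has_derivative_inner[OF has_derivative_ident 1(1)])
  have i2: "((\<lambda>y. y \<bullet> g\<^sub>2 y) has_derivative (\<lambda>h. x \<bullet> D\<^sub>2 h + h \<bullet> g\<^sub>2 x)) (at x)"
    by (rule has_derivative_inner[OF has_derivative_ident 2(1)])
  have i3: "((\<lambda>y. g\<^sub>1 y \<bullet> g\<^sub>2 y) has_derivative (\<lambda>h. g\<^sub>1 x \<bullet> D\<^sub>2 h + D\<^sub>1 h \<bullet> g\<^sub>2 x)) (at x)"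
    by (rule has_derivative_inner[OF 1(1) 2(1)])
  have d: "(\<lambda>y. (y \<bullet> g\<^sub>1 y) *\<^sub>R g\<^sub>2 y) differentiable (at x)" "(\<lambda>y. (y \<bullet> g\<^sub>2 y) *\<^sub>R g\<^sub>1 y) differentiable (at x)"
    "(\<lambda>y. (g\<^sub>1 y \<bullet> g\<^sub>2 y) *\<^sub>R y) differentiable (at x)"
    by (rule differentiable_scaleR; use i1 i2 i3 diff in \<open>auto intro: differentiableI\<close>)+
  have "divergence (\<lambda>y. (y \<bullet> g\<^sub>1 y) *\<^sub>R g\<^sub>2 y + (y \<bullet> g\<^sub>2 y) *\<^sub>R g\<^sub>1 y - (g\<^sub>1 y \<bullet> g\<^sub>2 y) *\<^sub>R y) x
    = divergence (\<lambda>y. (y \<bullet> g\<^sub>1 y) *\<^sub>R g\<^sub>2 y) x + divergence (\<lambda>y. (y \<bullet> g\<^sub>2 y) *\<^sub>R g\<^sub>1 y) x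
      - divergence (\<lambda>y. (g\<^sub>1 y \<bullet> g\<^sub>2 y) *\<^sub>R y) x"
    using d by (simp add: divergence_diff divergence_add)
  also have "\<dots> = (x \<bullet> D\<^sub>1 (g\<^sub>2 x) + g\<^sub>2 x \<bullet> g\<^sub>1 x + (x \<bullet> g\<^sub>1 x) * divergence g\<^sub>2 x)
      + (x \<bullet> D\<^sub>2 (g\<^sub>1 x) + g\<^sub>1 x \<bullet> g\<^sub>2 x + (x \<bullet> g\<^sub>2 x) * divergence g\<^sub>1 x)
      - (g\<^sub>1 x \<bullet> D\<^sub>2 x + D\<^sub>1 x \<bullet> g\<^sub>2 x + (g\<^sub>1 x \<bullet> g\<^sub>2 x) * real CARD('n))"
    using diff by (simp add: divergence_scaleR[OF i1] divergence_scaleR[OF i2] divergence_scaleR[OF i3] divergence_ident)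
  also have "x \<bullet> D\<^sub>1 (g\<^sub>2 x) = D\<^sub>1 x \<bullet> g\<^sub>2 x" using 1(2)[of "g\<^sub>2 x" x] by (simp add: inner_commute)
  also have "x \<bullet> D\<^sub>2 (g\<^sub>1 x) = g\<^sub>1 x \<bullet> D\<^sub>2 x" using 2(2)[of "g\<^sub>1 x" x] by (simp add: inner_commute)
  also have "g\<^sub>2 x \<bullet> g\<^sub>1 x = g\<^sub>1 x \<bullet> g\<^sub>2 x" by (rule inner_commute)
  finally show ?thesis by (simp add: algebra_simps)
qed

text \<open>The chain rule for \<open>H(x, u x, v x)\<close> produces a total derivative of \<open>H\<close>; this splits it into the three
  groups of partial derivatives that occur in the system and in the structural inequality.\<close>

lemma dderiv_sum_eq_derivative:
  fixes H :: "('n::finite, 'm::finite) hamiltonian"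
  assumes H: "(H has_derivative D) (at z)"
  shows "(\<Sum>i\<in>UNIV. x $ i * H_x H i z) + (\<Sum>k\<in>UNIV. a $ k * H_u H k z + b $ k * H_v H k z) = D (x, a, b)"
proof -
  have lin: "linear D" using H by (rule has_derivative_linear)
  have "(\<Sum>i\<in>UNIV. x $ i * H_x H i z) = D (x, 0, 0)"
  proof -
    have "linear (\<lambda>x. D (x, 0, 0))"
      using lin by (intro linear_compose[of "\<lambda>x. (x, 0, 0)" D, unfolded o_def]) (auto intro!: linearI)
    from linear_eq_sum_axis[OF this, of x] show ?thesis by (simp add: H_x_def dderiv_eq[OF H])
  qed
  moreover have "(\<Sum>k\<in>UNIV. a $ k * H_u H k z) = D (0, a, 0)"
  proof -
    have "linear (\<lambda>a. D (0, a, 0))"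
      using lin by (intro linear_compose[of "\<lambda>a. (0, a, 0)" D, unfolded o_def]) (auto intro!: linearI)
    from linear_eq_sum_axis[OF this, of a] show ?thesis by (simp add: H_u_def dderiv_eq[OF H])
  qed
  moreover have "(\<Sum>k\<in>UNIV. b $ k * H_v H k z) = D (0, 0, b)"
  proof -
    have "linear (\<lambda>b. D (0, 0, b))"
      using lin by (intro linear_compose[of "\<lambda>b. (0, 0, b)" D, unfolded o_def]) (auto intro!: linearI)
    from linear_eq_sum_axis[OF this, of b] show ?thesis by (simp add: H_v_def dderiv_eq[OF H])
  qed
  moreover have "D (x, a, b) = D (x, 0, 0) + D (0, a, 0) + D (0, 0, b)"
    by (simp flip: linear_add[OF lin])
  ultimately show ?thesis by (simp add: sum.distrib)
qed

theorem proposition1: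
  fixes \<Omega> :: "(real^'n) set" and \<nu> :: "real^'n \<Rightarrow> real^'n"
    and H :: "(real^'n) \<times> (real^'m) \<times> (real^'m) \<Rightarrow> real"
    and \<alpha> :: "'m \<Rightarrow> real"
  assumes "smooth_bounded_domain \<Omega> \<nu>"
    and "star_shaped \<Omega> \<nu>"
    and "C2_on (\<Omega> \<times> pos_orthant \<times> pos_orthant) H"
    and "continuous_on (closure \<Omega> \<times> nonneg_orthant \<times> nonneg_orthant) H"
    and "\<And>x. x \<in> frontier \<Omega> \<Longrightarrow> H (x, 0, 0) = 0"
    and "\<And>x a b. x \<in> \<Omega> \<Longrightarrow> a \<in> pos_orthant \<Longrightarrow> b \<in> pos_orthant \<Longrightarrow>
           real CARD('n) * H (x, a, b)
           + (2 - real CARD('n)) *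
               (\<Sum>k\<in>UNIV. \<alpha> k * a $ k * H_u H k (x, a, b)
                         + (1 - \<alpha> k) * b $ k * H_v H k (x, a, b))
           + (\<Sum>i\<in>UNIV. x $ i * H_x H i (x, a, b)) < 0"
  shows "\<not> (\<exists>u v. classical_solution \<Omega> H u v \<and> positive_on \<Omega> u v)"
proof (intro notI, elim exE conjE)
  fix u v assume sol: "classical_solution \<Omega> H u v" and pos: "positive_on \<Omega> u v"
  have \<Omega>: "open \<Omega>" and normal: "\<And>x. x \<in> frontier \<Omega> \<Longrightarrow> outward_unit_normal \<Omega> x (\<nu> x)"
    using assms(1) by (auto simp: smooth_bounded_domain_def)
  have closure_eq: "closure \<Omega> = \<Omega> \<union> frontier \<Omega>" by (rule closure_Un_frontier)
  have C2: "C2_on \<Omega> (\<lambda>x. u x $ k)" "C2_on \<Omega> (\<lambda>x. v x $ k)"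
    and C1cl: "C1_closure \<Omega> (\<lambda>x. u x $ k)" "C1_closure \<Omega> (\<lambda>x. v x $ k)"
    and zero: "\<And>x. x \<in> frontier \<Omega> \<Longrightarrow> u x $ k = 0" "\<And>x. x \<in> frontier \<Omega> \<Longrightarrow> v x $ k = 0"
    and eqn: "\<And>x. x \<in> \<Omega> \<Longrightarrow> laplacian (\<lambda>y. u y $ k) x = - H_v H k (x, u x, v x)"
      "\<And>x. x \<in> \<Omega> \<Longrightarrow> laplacian (\<lambda>y. v y $ k) x = - H_u H k (x, u x, v x)" for k
    using sol unfolding classical_solution_def by (auto simp: eq_neg_iff_add_eq_0)
  have posu: "0 < u x $ k" "0 < v x $ k" if "x \<in> \<Omega>" for x k
    using pos that unfolding positive_on_def by auto

  have "\<forall>k. \<exists>g. continuous_on (closure \<Omega>) g \<and> C1_on \<Omega> g \<and>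
      (\<forall>x\<in>\<Omega>. ((\<lambda>y. u y $ k) has_derivative (\<lambda>h. g x \<bullet> h)) (at x)) \<and>
      (\<forall>x\<in>\<Omega>. divergence g x = laplacian (\<lambda>y. u y $ k) x)"
    by (intro allI) (rule gradient_field[OF \<Omega> C2(1) C1cl(1)], blast)
  then obtain p where p: "\<And>k. continuous_on (closure \<Omega>) (p k)" "\<And>k. C1_on \<Omega> (p k)"
    "\<And>k x. x \<in> \<Omega> \<Longrightarrow> ((\<lambda>y. u y $ k) has_derivative (\<lambda>h. p k x \<bullet> h)) (at x)"
    "\<And>k x. x \<in> \<Omega> \<Longrightarrow> divergence (p k) x = laplacian (\<lambda>y. u y $ k) x"
    by metis
  have "\<forall>k. \<exists>g. continuous_on (closure \<Omega>) g \<and> C1_on \<Omega> g \<and>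
      (\<forall>x\<in>\<Omega>. ((\<lambda>y. v y $ k) has_derivative (\<lambda>h. g x \<bullet> h)) (at x)) \<and>
      (\<forall>x\<in>\<Omega>. divergence g x = laplacian (\<lambda>y. v y $ k) x)"
    by (intro allI) (rule gradient_field[OF \<Omega> C2(2) C1cl(2)], blast)
  then obtain q where q: "\<And>k. continuous_on (closure \<Omega>) (q k)" "\<And>k. C1_on \<Omega> (q k)"
    "\<And>k x. x \<in> \<Omega> \<Longrightarrow> ((\<lambda>y. v y $ k) has_derivative (\<lambda>h. q k x \<bullet> h)) (at x)"
    "\<And>k x. x \<in> \<Omega> \<Longrightarrow> divergence (q k) x = laplacian (\<lambda>y. v y $ k) x"
    by metis

  \<comment> \<open>\<open>R\<close> is Rellich's field, whose divergence contains \<open>(2 - n)\<close> times the product of the gradients; subtracting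
    \<open>(2 - n)\<close> times \<open>Q\<close> trades that product for the terms weighted by \<open>\<alpha>\<close>, and \<open>h\<close> times the position field cancels
    the derivatives of \<open>u\<close> and \<open>v\<close> along \<open>x\<close>.\<close>
  define h where "h x = H (x, u x, v x)" for x
  define R where "R k x = (x \<bullet> p k x) *\<^sub>R q k x + (x \<bullet> q k x) *\<^sub>R p k x - (p k x \<bullet> q k x) *\<^sub>R x" for k x
  define Q where "Q k x = (\<alpha> k * u x $ k) *\<^sub>R q k x + ((1 - \<alpha> k) * v x $ k) *\<^sub>R p k x" for k x
  define F where "F x = (\<Sum>k\<in>UNIV. R k x) + h x *\<^sub>R x - (2 - real CARD('n)) *\<^sub>R (\<Sum>k\<in>UNIV. Q k x)" for x

  have conts: "continuous_on (closure \<Omega>) (\<lambda>x. u x $ k)" "continuous_on (closure \<Omega>) (\<lambda>x. v x $ k)" for k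
    using C1cl unfolding C1_closure_def by auto
  have contuv: "continuous_on (closure \<Omega>) u" "continuous_on (closure \<Omega>) v"
    using continuous_on_vec_lambda[of "closure \<Omega>" "\<lambda>k x. u x $ k"]
      continuous_on_vec_lambda[of "closure \<Omega>" "\<lambda>k x. v x $ k"] conts by simp_all
  have conth: "continuous_on (closure \<Omega>) h"
    unfolding h_def[abs_def]
  proof (rule continuous_on_compose2[OF assms(4)])
    show "continuous_on (closure \<Omega>) (\<lambda>x. (x, u x, v x))" by (intro continuous_intros contuv)
    show "(\<lambda>x. (x, u x, v x)) ` closure \<Omega> \<subseteq> closure \<Omega> \<times> nonneg_orthant \<times> nonneg_orthant"
      using posu zero by (auto simp: closure_eq nonneg_orthant_def less_imp_le)
  qed
  have contF: "continuous_on (closure \<Omega>) F"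
    unfolding F_def R_def Q_def by (intro continuous_intros conth p(1) q(1) conts)

  have C1uv: "C1_on \<Omega> (\<lambda>x. u x $ k)" "C1_on \<Omega> (\<lambda>x. v x $ k)" for k
    by (intro C2_on_imp_C1_on C2)+
  have C1h: "C1_on \<Omega> h"
    unfolding h_def[abs_def]
  proof (rule C1_on_compose[OF _ C2_on_imp_C1_on[OF assms(3)]])
    show "C1_on \<Omega> (\<lambda>x. (x, u x, v x))"
      by (intro C1_on_Pair C1_on_ident C1_on_vec C1uv)
    show "(\<lambda>x. (x, u x, v x)) ` \<Omega> \<subseteq> \<Omega> \<times> pos_orthant \<times> pos_orthant"
      using posu by (auto simp: pos_orthant_def)
  qed
  have C1R: "C1_on \<Omega> (R k)" and C1Q: "C1_on \<Omega> (Q k)" for k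
    unfolding R_def[abs_def] Q_def[abs_def]
    by (intro C1_on_add C1_on_diff C1_on_scaleR C1_on_inner C1_on_mult C1_on_ident C1_on_const p(2) q(2) C1uv)+
  have C1F: "C1_on \<Omega> F"
    unfolding F_def[abs_def]
    by (intro C1_on_add C1_on_diff C1_on_scaleR C1_on_sum C1_on_ident C1_on_const C1R C1Q C1h)

  have flux: "0 \<le> F x \<bullet> \<nu> x" if x: "x \<in> frontier \<Omega>" for x
  proof -
    have uv0: "u x = 0" "v x = 0" using zero[OF x] by (auto simp: vec_eq_iff)
    have xc: "x \<in> closure \<Omega>" using x by (simp add: closure_eq)
    have nn: "\<nu> x \<bullet> \<nu> x = 1" using normal[OF x] by (simp add: outward_unit_normal_def dot_square_norm)
    have "0 \<le> R k x \<bullet> \<nu> x" for k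
    proof -
      obtain a where a: "a \<le> 0" "p k x = a *\<^sub>R \<nu> x"
        using boundary_gradient[OF normal[OF x] xc conts(1) p(1,3)] posu zero[OF x] by metis
      obtain b where b: "b \<le> 0" "q k x = b *\<^sub>R \<nu> x"
        using boundary_gradient[OF normal[OF x] xc conts(2) q(1,3)] posu zero[OF x] by metis
      have "R k x \<bullet> \<nu> x = (a * b) * (x \<bullet> \<nu> x)"
        by (simp add: R_def a b inner_add_left inner_diff_left nn)
      moreover have "0 \<le> x \<bullet> \<nu> x" using assms(2) x by (simp add: star_shaped_def)
      ultimately show ?thesis using a b by (simp add: mult_nonpos_nonpos)
    qed
    moreover have "Q k x = 0" for k by (simp add: Q_def uv0)
    moreover have "h x = 0" using assms(5)[OF x] by (simp add: h_def uv0)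
    ultimately show ?thesis by (simp add: F_def inner_sum_left sum_nonneg)
  qed

  have "divergence F x < 0" if x: "x \<in> \<Omega>" for x
  proof -
    let ?z = "(x, u x, v x)" and ?n = "real CARD('n)"
    have uvpos: "u x \<in> pos_orthant" "v x \<in> pos_orthant" using posu[OF x] by (auto simp: pos_orthant_def)
    have divR: "divergence (R k) x = (2 - ?n) * (p k x \<bullet> q k x)
        - ((p k x \<bullet> x) * H_u H k ?z + (q k x \<bullet> x) * H_v H k ?z)" for k
    proof -
      obtain D\<^sub>1 where D1: "(p k has_derivative D\<^sub>1) (at x)"
        using C1_on_imp_differentiable[OF p(2) x] unfolding differentiable_def by blast
      obtain D\<^sub>2 where D2: "(q k has_derivative D\<^sub>2) (at x)"
        using C1_on_imp_differentiable[OF q(2) x] unfolding differentiable_def by blast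
      show ?thesis
        unfolding R_def[abs_def]
        using rellich_divergence[OF D1 hessian_symmetric[OF \<Omega> x p(3) D1] D2 hessian_symmetric[OF \<Omega> x q(3) D2]]
        by (simp add: p(4)[OF x] q(4)[OF x] eqn[OF x] inner_commute)
    qed
    have divQ: "divergence (Q k) x = p k x \<bullet> q k x
        - (\<alpha> k * u x $ k * H_u H k ?z + (1 - \<alpha> k) * v x $ k * H_v H k ?z)" for k
    proof -
      have du: "((\<lambda>y. \<alpha> k * u y $ k) has_derivative (\<lambda>h. \<alpha> k * (p k x \<bullet> h))) (at x)"
        by (rule has_derivative_mult_right[OF p(3)[OF x]])
      have dv: "((\<lambda>y. (1 - \<alpha> k) * v y $ k) has_derivative (\<lambda>h. (1 - \<alpha> k) * (q k x \<bullet> h))) (at x)"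
        by (rule has_derivative_mult_right[OF q(3)[OF x]])
      have diff: "p k differentiable (at x)" "q k differentiable (at x)"
        using C1_on_imp_differentiable x p(2) q(2) by blast+
      have "divergence (Q k) x = divergence (\<lambda>y. (\<alpha> k * u y $ k) *\<^sub>R q k y) x
          + divergence (\<lambda>y. ((1 - \<alpha> k) * v y $ k) *\<^sub>R p k y) x"
        unfolding Q_def[abs_def]
        by (intro divergence_add differentiable_scaleR differentiableI[OF du] differentiableI[OF dv] diff)
      also have "\<dots> = (\<alpha> k * (p k x \<bullet> q k x) - \<alpha> k * u x $ k * H_u H k ?z)
          + ((1 - \<alpha> k) * (p k x \<bullet> q k x) - (1 - \<alpha> k) * v x $ k * H_v H k ?z)"
        using diff by (simp add: divergence_scaleR[OF du] divergence_scaleR[OF dv] p(4)[OF x] q(4)[OF x] eqn[OF x]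
            inner_commute)
      finally show ?thesis by (simp add: left_diff_distrib)
    qed
    have divh: "divergence (\<lambda>y. h y *\<^sub>R y) x = (\<Sum>i\<in>UNIV. x $ i * H_x H i ?z)
        + (\<Sum>k\<in>UNIV. (p k x \<bullet> x) * H_u H k ?z + (q k x \<bullet> x) * H_v H k ?z) + ?n * H ?z"
    proof -
      have "?z \<in> \<Omega> \<times> pos_orthant \<times> pos_orthant" using x uvpos by simp
      then obtain D where D: "(H has_derivative D) (at ?z)"
        using C1_on_imp_differentiable[OF C2_on_imp_C1_on[OF assms(3)]] unfolding differentiable_def by blast
      have vec: "(w has_derivative (\<lambda>h. \<chi> k. g k \<bullet> h)) (at x)"
        if "\<And>k. ((\<lambda>y. w y $ k) has_derivative (\<lambda>h. g k \<bullet> h)) (at x)" for w :: "real^'n \<Rightarrow> real^'m" and g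
      proof -
        have "((\<lambda>y. \<Sum>k\<in>UNIV. w y $ k *\<^sub>R axis k (1::real)) has_derivative
            (\<lambda>h. \<Sum>k\<in>UNIV. (g k \<bullet> h) *\<^sub>R axis k 1)) (at x)"
          by (intro has_derivative_sum has_derivative_scaleR_left that)
        moreover have "(\<Sum>k\<in>UNIV. c k *\<^sub>R axis k (1::real)) = (\<chi> k. c k)" for c :: "'m \<Rightarrow> real"
          using basis_expansion[of "\<chi> k. c k"] by (simp flip: scalar_mult_eq_scaleR)
        ultimately show ?thesis by simp
      qed
      have "(h has_derivative (\<lambda>k. D (k, (\<chi> j. p j x \<bullet> k), (\<chi> j. q j x \<bullet> k)))) (at x)"
        unfolding h_def[abs_def]
        by (rule has_derivative_compose[where g = H and f = "\<lambda>y. (y, u y, v y)"])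
          (intro has_derivative_Pair has_derivative_ident vec p(3) q(3) x D)+
      from divergence_scaleR[OF this, of "\<lambda>y. y"]
      have "divergence (\<lambda>y. h y *\<^sub>R y) x = D (x, (\<chi> j. p j x \<bullet> x), (\<chi> j. q j x \<bullet> x)) + h x * ?n"
        by (simp add: divergence_ident)
      then show ?thesis
        by (simp add: h_def flip: dderiv_sum_eq_derivative[OF D])
    qed
    have diff: "R k differentiable (at x)" "Q k differentiable (at x)" "h differentiable (at x)" for k
      using C1_on_imp_differentiable x C1R C1Q C1h by blast+
    have diff2: "(\<lambda>y. \<Sum>k\<in>UNIV. R k y) differentiable (at x)" "(\<lambda>y. \<Sum>k\<in>UNIV. Q k y) differentiable (at x)"
      "(\<lambda>y. h y *\<^sub>R y) differentiable (at x)"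
      using diff by (auto intro!: differentiable_sum differentiable_scaleR)
    have "divergence F x = (\<Sum>k\<in>UNIV. divergence (R k) x) + divergence (\<lambda>y. h y *\<^sub>R y) x
        - (2 - ?n) * (\<Sum>k\<in>UNIV. divergence (Q k) x)"
      unfolding F_def[abs_def] using diff diff2
      by (simp add: divergence_diff divergence_add divergence_sum divergence_scaleR[OF has_derivative_const]
          differentiable_scaleR)
    also have "\<dots> = ?n * H ?z
        + (2 - ?n) * (\<Sum>k\<in>UNIV. \<alpha> k * u x $ k * H_u H k ?z + (1 - \<alpha> k) * v x $ k * H_v H k ?z)
        + (\<Sum>i\<in>UNIV. x $ i * H_x H i ?z)"
      unfolding divR divQ divh
      by (simp add: sum_subtractf sum.distrib sum_distrib_left right_diff_distrib)
    also have "\<dots> < 0" by (rule assms(6)[OF x uvpos])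
    finally show ?thesis .
  qed
  then show False
    using outward_flux_imp_nonneg_divergence[OF assms(1) contF C1F flux] by force
qed

end
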